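(* For every integer $n\ge 1$, the antibandwidth of the $n$-cube $Q^{(n)}$ is $$f(Q^{(n)}) = 2^{n-1}-\sum_{m=0}^{n-2}\binom{m}{\lfloor m/2\rfloor}.$$
   Context: The $n$-cube $Q^{(n)}$ is the graph with vertex set $\{0,1\}^n$ in which two vertices are adjacent iff they differ in exactly one coordinate. A numbering of a finite graph $G=(V,E)$ is a bijection $\eta:V\to\{1,2,\dots,|V|\}$. The antibandwidth of $G$ is $f(G)=\max_{\eta}\min_{\{v,w\}\in E}|\eta(v)-\eta(w)|$, the maximum taken over all numberings $\eta$ of $G$. An empty sum equals $0$. *)

theory Defs
  imports Main
begin

text \<open>A finite graph is given by a finite vertex set V and a symmetric adjacency
  predicate adj; edges are the pairs {v,w} with v, w in V and adj v w.\<close>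

definition numbering :: "'a set \<Rightarrow> ('a \<Rightarrow> nat) \<Rightarrow> bool" where
  "numbering V \<eta> \<longleftrightarrow> bij_betw \<eta> V {1..card V}"

definition min_edge_gap :: "'a set \<Rightarrow> ('a \<Rightarrow> 'a \<Rightarrow> bool) \<Rightarrow> ('a \<Rightarrow> nat) \<Rightarrow> int" where
  "min_edge_gap V adj \<eta> =
     Min {\<bar>int (\<eta> v) - int (\<eta> w)\<bar> | v w. v \<in> V \<and> w \<in> V \<and> adj v w}"

definition antibandwidth :: "'a set \<Rightarrow> ('a \<Rightarrow> 'a \<Rightarrow> bool) \<Rightarrow> int" where
  "antibandwidth V adj = Max {min_edge_gap V adj \<eta> | \<eta>. numbering V \<eta>}"

definition cube_vertices :: "nat \<Rightarrow> bool list set" where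
  "cube_vertices n = {xs. length xs = n}"

definition cube_adj :: "bool list \<Rightarrow> bool list \<Rightarrow> bool" where
  "cube_adj xs ys \<longleftrightarrow> length xs = length ys \<and>
     card {i. i < length xs \<and> xs ! i \<noteq> ys ! i} = 1"

end

theory Submission
  imports Defs Complex_Main
begin

text \<open>
  Write \<open>n = d + 1\<close>, \<open>N = 2 ^ d\<close> and \<open>c = (\<Sum>m<d. m choose (m div 2))\<close>, and identify vertices with
  finite sets. By Harper's vertex-isoperimetric theorem, initial segments of the simplicial order
  have the smallest closed neighbourhoods; in the \<open>d\<close>-cube the rank in that order changes by at
  most \<open>c\<close> along an edge, with equality somewhere, so there is a size \<open>s\<close> for which every
  \<open>S\<close> with \<open>s\<close> elements has at least \<open>s + c\<close> elements in its closed neighbourhood.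

  Dropping one coordinate maps the even vertices of the \<open>n\<close>-cube, and likewise the odd ones,
  bijectively onto the \<open>d\<close>-cube. Listing all even vertices by the rank of their projection before
  all odd ones gives the gap \<open>N - c\<close>. On the other hand, if \<open>X\<close> and \<open>Y\<close> are sets of vertices of
  opposite parity with no edge between them, then the projection of \<open>Y\<close> lies outside the closed
  neighbourhood of the projection of \<open>X\<close>, so \<open>card X = s\<close> forces \<open>card X + card Y \<le> N - c\<close>.

  Let a numbering have gaps at least \<open>k\<close>, and orient every edge towards the larger label. If every
  4-cycle is balanced (two edges each way), the orientation comes from a height function. Sweeping
  heights and labels yields such pairs \<open>X\<close>, \<open>Y\<close> with \<open>card X + card Y \<ge> k\<close>, where \<open>card X\<close> starts
  at \<open>N\<close>, ends at \<open>0\<close> and never drops by more than one; at \<open>card X = s\<close> this gives \<open>k + c \<le> N\<close>. An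
  unbalanced 4-cycle carries labels that increase three times by at least \<open>k\<close>, so they lie in four
  short intervals. Since every 3-cube around an unbalanced face has a second one, at least \<open>2 n\<close>
  vertices have such labels, which contradicts \<open>k + c > N\<close> unless \<open>d = 5\<close>; in that case the parities
  of the labels turn out to be periodic with period \<open>20\<close>, which improves every gap to \<open>21\<close>.
\<close>

section \<open>Toggling a coordinate\<close>

definition toggle :: "'a \<Rightarrow> 'a set \<Rightarrow> 'a set" where
  "toggle i x = (if i \<in> x then x - {i} else insert i x)"

lemma mem_toggle_iff: "j \<in> toggle i x \<longleftrightarrow> (j \<in> x \<longleftrightarrow> j \<noteq> i)"
  by (auto simp: toggle_def)

lemma toggle_toggle [simp]: "toggle i (toggle i x) = x"
  by (auto simp: mem_toggle_iff)

lemma toggle_commute: "toggle i (toggle j x) = toggle j (toggle i x)"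
  by (auto simp: mem_toggle_iff)

lemma toggle_eq_iff [simp]: "toggle i x = toggle i y \<longleftrightarrow> x = y"
  by (metis toggle_toggle)

lemma toggle_same_eq_iff [simp]: "toggle i x = toggle j x \<longleftrightarrow> i = j"
  by (metis mem_toggle_iff)

lemma toggle_neq [simp]: "toggle i x \<noteq> x" "x \<noteq> toggle i x"
  by (metis mem_toggle_iff)+

lemma toggle_in_Pow: "x \<in> Pow A \<Longrightarrow> i \<in> A \<Longrightarrow> toggle i x \<in> Pow A"
  by (auto simp: toggle_def)

lemma even_card_toggle:
  assumes "finite x"
  shows "even (card (toggle i x)) \<longleftrightarrow> odd (card x)"
proof (cases "i \<in> x")
  case True
  then have "Suc (card (toggle i x)) = card x"
    using assms card_Suc_Diff1[of x i] by (simp add: toggle_def del: card_Diff_insert)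
  then show ?thesis
    by (metis even_Suc)
qed (use assms in \<open>simp add: toggle_def\<close>)

lemma toggle_diff_singleton: "i \<noteq> a \<Longrightarrow> toggle i x - {a} = toggle i (x - {a})"
  by (auto simp: mem_toggle_iff)

lemma toggle_same_diff_singleton [simp]: "toggle a x - {a} = x - {a}"
  by (auto simp: mem_toggle_iff)

lemma diff_singleton_eqD: "x - {a} = y - {a} \<Longrightarrow> x = y \<or> x = toggle a y"
  by (auto simp: toggle_def split: if_splits)

lemma card_le_of_subset_Pow:
  assumes "finite A" "S \<subseteq> Pow A"
  shows "card S \<le> 2 ^ card A"
  using card_mono[OF _ assms(2)] assms(1) by (simp add: card_Pow)

definition closed_nbhd :: "'a set \<Rightarrow> 'a set set \<Rightarrow> 'a set set" where
  "closed_nbhd A S = {x. x \<in> S \<or> (\<exists>i\<in>A. toggle i x \<in> S)}"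

lemma subset_closed_nbhd: "S \<subseteq> closed_nbhd A S"
  by (auto simp: closed_nbhd_def)

lemma closed_nbhd_subset_Pow: "S \<subseteq> Pow A \<Longrightarrow> closed_nbhd A S \<subseteq> Pow A"
  by (auto simp: closed_nbhd_def) (metis PowD mem_toggle_iff subsetD)

lemma finite_closed_nbhd: "finite A \<Longrightarrow> S \<subseteq> Pow A \<Longrightarrow> finite (closed_nbhd A S)"
  by (meson closed_nbhd_subset_Pow finite_Pow_iff finite_subset)

lemma closed_nbhd_Un: "closed_nbhd A (S \<union> T) = closed_nbhd A S \<union> closed_nbhd A T"
  by (auto simp: closed_nbhd_def)

lemma insert_in_closed_nbhd: "x \<in> S \<Longrightarrow> i \<in> A \<Longrightarrow> insert i x \<in> closed_nbhd A S"
  by (cases "i \<in> x") (auto simp: closed_nbhd_def toggle_def insert_absorb)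

section \<open>The simplicial order\<close>

definition simplicial_less :: "'a::wellorder set \<Rightarrow> 'a set \<Rightarrow> bool" (infix "\<prec>" 50) where
  "x \<prec> y \<longleftrightarrow> card x < card y \<or>
     (card x = card y \<and> (\<exists>m\<in>x - y. \<forall>j<m. j \<in> x \<longleftrightarrow> j \<in> y))"

lemma simplicial_less_if_card_less: "card x < card y \<Longrightarrow> x \<prec> y"
  by (simp add: simplicial_less_def)

lemma simplicial_lessI:
  "card x = card y \<Longrightarrow> m \<in> x \<Longrightarrow> m \<notin> y \<Longrightarrow> (\<And>j. j < m \<Longrightarrow> j \<in> x \<longleftrightarrow> j \<in> y) \<Longrightarrow> x \<prec> y"
  unfolding simplicial_less_def by blast

lemma simplicial_less_cases:
  assumes "x \<prec> y"
  obtains (card) "card x < card y"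
    | (lex) m where "card x = card y" "m \<in> x" "m \<notin> y" "\<And>j. j < m \<Longrightarrow> j \<in> x \<longleftrightarrow> j \<in> y"
  using assms unfolding simplicial_less_def by blast

lemma card_le_if_simplicial_less: "x \<prec> y \<Longrightarrow> card x \<le> card y"
  by (auto elim: simplicial_less_cases)

lemma not_simplicial_less_self [simp]: "\<not> x \<prec> x"
  by (auto elim: simplicial_less_cases)

lemma simplicial_less_trans:
  assumes xy: "x \<prec> y" and yz: "y \<prec> z"
  shows "x \<prec> z"
  using xy
proof (cases rule: simplicial_less_cases)
  case card
  then show ?thesis
    using card_le_if_simplicial_less[OF yz] by (simp add: simplicial_less_if_card_less)
next
  case (lex m)
  show ?thesis
    using yz
  proof (cases rule: simplicial_less_cases)
    case card
    then show ?thesis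
      using lex(1) by (simp add: simplicial_less_if_card_less)
  next
    case lex': (lex l)
    have "min m l \<in> x" "min m l \<notin> z" "\<And>j. j < min m l \<Longrightarrow> j \<in> x \<longleftrightarrow> j \<in> z"
      using lex lex' by (cases m l rule: linorder_cases; auto)+
    then show ?thesis
      using lex(1) lex'(1) by (auto intro: simplicial_lessI)
  qed
qed

lemma simplicial_less_asym: "x \<prec> y \<Longrightarrow> \<not> y \<prec> x"
  using simplicial_less_trans not_simplicial_less_self by blast

lemma simplicial_less_linear:
  assumes "x \<noteq> y"
  shows "x \<prec> y \<or> y \<prec> x"
proof -
  have ex: "\<exists>m. m \<in> x \<longleftrightarrow> m \<notin> y"
    using assms by blast
  define m where "m = (LEAST m. m \<in> x \<longleftrightarrow> m \<notin> y)"
  have "m \<in> x \<longleftrightarrow> m \<notin> y"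
    unfolding m_def using LeastI_ex[OF ex] .
  moreover have "\<forall>j<m. j \<in> x \<longleftrightarrow> j \<in> y"
    unfolding m_def using not_less_Least by blast
  ultimately show ?thesis
    unfolding simplicial_less_def by (metis DiffI linorder_neqE_nat)
qed

lemma insert_simplicial_less_insert_iff:
  assumes "finite x" "finite y" "i \<notin> x" "i \<notin> y"
  shows "insert i x \<prec> insert i y \<longleftrightarrow> x \<prec> y"
proof -
  have "(\<exists>m\<in>insert i x - insert i y. \<forall>j<m. j \<in> insert i x \<longleftrightarrow> j \<in> insert i y)
      \<longleftrightarrow> (\<exists>m\<in>x - y. \<forall>j<m. j \<in> x \<longleftrightarrow> j \<in> y)"
    using assms by auto
  then show ?thesis
    using assms by (simp add: simplicial_less_def)
qed

lemma insert_simplicial_less_insert_top: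
  assumes "finite x" "finite y" "i \<notin> x" "\<And>j. j \<in> y \<Longrightarrow> j < M" and xy: "x \<prec> y"
  shows "insert i x \<prec> insert M y"
proof -
  have "M \<notin> y"
    using assms(4) by blast
  then have card: "card (insert i x) = Suc (card x)" "card (insert M y) = Suc (card y)"
    using assms by auto
  show ?thesis
    using xy
  proof (cases rule: simplicial_less_cases)
    case (lex m)
    have "\<not> y \<subseteq> x"
      using lex(1,2,3) \<open>finite x\<close> by (metis card_subset_eq)
    then have "m < M"
      using lex(4) assms(4) by (metis linorder_le_less_linear order_less_le_trans subsetI)
    show ?thesis
    proof (rule simplicial_lessI)
      show "card (insert i x) = card (insert M y)"
        using card lex(1) by simp
      show "min i m \<in> insert i x" "min i m \<notin> insert M y"
        using lex(2,3) lex(4)[of i] \<open>m < M\<close> \<open>i \<notin> x\<close> by (auto simp: min_def le_less)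
      show "j \<in> insert i x \<longleftrightarrow> j \<in> insert M y" if "j < min i m" for j
        using that lex(4) \<open>m < M\<close> by auto
    qed
  qed (simp add: card simplicial_less_if_card_less)
qed

lemma simplicial_less_exchange:
  assumes "finite x" "j \<in> x" "l \<notin> x" "j < l"
  shows "x \<prec> insert l (x - {j})"
proof (rule simplicial_lessI)
  show "card x = card (insert l (x - {j}))"
    using assms card_Suc_Diff1[of x j] by (simp del: card_Diff_insert)
qed (use assms in auto)

lemma insert_min_simplicial_less_iff:
  assumes "finite x" "finite y" "\<forall>j\<in>x. a < j" "\<forall>j\<in>y. a < j"
  shows "insert a x \<prec> y \<longleftrightarrow> card x < card y"
    and "x \<prec> insert a y \<longleftrightarrow> card x \<le> card y"
proof -
  have a: "a \<notin> x" "a \<notin> y"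
    using assms by auto
  have "a \<in> insert a x - y" "\<forall>j<a. j \<in> insert a x \<longleftrightarrow> j \<in> y"
    using assms a by auto
  then have "\<exists>m\<in>insert a x - y. \<forall>j<m. j \<in> insert a x \<longleftrightarrow> j \<in> y"
    by blast
  then show "insert a x \<prec> y \<longleftrightarrow> card x < card y"
    using assms(1) a by (auto simp: simplicial_less_def)
  have "\<not> (\<exists>m\<in>x - insert a y. \<forall>j<m. j \<in> x \<longleftrightarrow> j \<in> insert a y)"
    using assms a by blast
  then show "x \<prec> insert a y \<longleftrightarrow> card x \<le> card y"
    using assms(2) a by (auto simp: simplicial_less_def)
qed

definition rank :: "'a::wellorder set \<Rightarrow> 'a set \<Rightarrow> nat" where
  "rank A x = card {z \<in> Pow A. z \<prec> x}"

lemma rank_less_rank: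
  assumes "finite A" "x \<in> Pow A" "x \<prec> y"
  shows "rank A x < rank A y"
  unfolding rank_def
proof (rule psubset_card_mono)
  have "x \<in> {z \<in> Pow A. z \<prec> y}" "x \<notin> {z \<in> Pow A. z \<prec> x}"
    using assms by auto
  moreover have "{z \<in> Pow A. z \<prec> x} \<subseteq> {z \<in> Pow A. z \<prec> y}"
    using assms simplicial_less_trans by blast
  ultimately show "{z \<in> Pow A. z \<prec> x} \<subset> {z \<in> Pow A. z \<prec> y}"
    by blast
qed (use assms in simp)

lemma rank_less_rank_iff:
  assumes "finite A" "x \<in> Pow A" "y \<in> Pow A"
  shows "rank A x < rank A y \<longleftrightarrow> x \<prec> y"
  using assms rank_less_rank simplicial_less_linear by (metis order_less_asym order_less_irrefl)

lemma inj_on_rank: "finite A \<Longrightarrow> inj_on (rank A) (Pow A)"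
  by (intro inj_onI) (metis rank_less_rank order_less_irrefl simplicial_less_linear)

lemma rank_less_card_Pow:
  assumes "finite A" "x \<in> Pow A"
  shows "rank A x < 2 ^ card A"
proof -
  have "x \<notin> {z \<in> Pow A. z \<prec> x}"
    by simp
  then have "{z \<in> Pow A. z \<prec> x} \<subset> Pow A"
    using assms by blast
  then have "rank A x < card (Pow A)"
    unfolding rank_def using assms by (intro psubset_card_mono) auto
  then show ?thesis
    using assms by (simp add: card_Pow)
qed

lemma bij_betw_rank:
  assumes "finite A"
  shows "bij_betw (rank A) (Pow A) {..<2 ^ card A}"
  unfolding bij_betw_def
proof
  show "rank A ` Pow A = {..<2 ^ card A}"
    using assms rank_less_card_Pow
    by (intro card_subset_eq) (auto simp: card_image inj_on_rank card_Pow)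
qed (rule inj_on_rank[OF assms])

definition is_initial :: "'a::wellorder set \<Rightarrow> 'a set set \<Rightarrow> bool" where
  "is_initial A T \<longleftrightarrow> T \<subseteq> Pow A \<and> (\<forall>x\<in>T. \<forall>z\<in>Pow A - T. x \<prec> z)"

definition initial_segment :: "'a::wellorder set \<Rightarrow> nat \<Rightarrow> 'a set set" where
  "initial_segment A s = {x \<in> Pow A. rank A x < s}"

lemma is_initialD: "is_initial A T \<Longrightarrow> x \<in> T \<Longrightarrow> z \<in> Pow A \<Longrightarrow> \<not> x \<prec> z \<Longrightarrow> z \<in> T"
  by (auto simp: is_initial_def)

lemma initial_segment_subset: "initial_segment A s \<subseteq> Pow A"
  by (auto simp: initial_segment_def)

lemma finite_initial_segment [simp]: "finite A \<Longrightarrow> finite (initial_segment A s)"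
  by (simp add: initial_segment_def)

lemma is_initial_initial_segment:
  assumes "finite A"
  shows "is_initial A (initial_segment A s)"
  unfolding is_initial_def
proof (intro conjI ballI)
  fix x z assume "x \<in> initial_segment A s" "z \<in> Pow A - initial_segment A s"
  then have "x \<in> Pow A" "z \<in> Pow A" "rank A x < rank A z"
    by (auto simp: initial_segment_def)
  then show "x \<prec> z"
    using rank_less_rank_iff[OF assms] by blast
qed (rule initial_segment_subset)

lemma card_initial_segment:
  assumes "finite A" "s \<le> 2 ^ card A"
  shows "card (initial_segment A s) = s"
proof -
  have "bij_betw (rank A) (initial_segment A s) {..<s}"
  proof (rule bij_betw_subset[OF bij_betw_rank[OF assms(1)] initial_segment_subset])
    have "{..<s} \<subseteq> rank A ` Pow A"
      using bij_betw_rank[OF assms(1)] assms(2) by (simp add: bij_betw_def)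
    then show "rank A ` initial_segment A s = {..<s}"
      by (auto simp: initial_segment_def)
  qed
  then show ?thesis
    using bij_betw_same_card by fastforce
qed

lemma is_initial_chain:
  assumes "is_initial A S" "is_initial A T"
  shows "S \<subseteq> T \<or> T \<subseteq> S"
proof (rule ccontr)
  assume "\<not> ?thesis"
  then obtain x y where "x \<in> S - T" "y \<in> T - S"
    by blast
  then have "x \<prec> y" "y \<prec> x"
    using assms by (auto simp: is_initial_def)
  then show False
    using simplicial_less_asym by blast
qed

lemma is_initial_eq_initial_segment:
  assumes "finite A" "is_initial A T"
  shows "T = initial_segment A (card T)"
proof -
  have T: "T \<subseteq> Pow A"
    using assms(2) by (simp add: is_initial_def)
  then have "finite T"
    using assms(1) finite_subset by blast
  then show ?thesis
    using is_initial_chain[OF assms(2) is_initial_initial_segment[OF assms(1), of "card T"]]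
      card_initial_segment[OF assms(1) card_le_of_subset_Pow[OF assms(1) T]] assms(1)
    by (metis card_subset_eq finite_initial_segment)
qed

lemma card_Un_is_initial:
  assumes "finite A" "is_initial A S" "is_initial A T"
  shows "card (S \<union> T) = max (card S) (card T)"
proof -
  have "finite S" "finite T"
    using assms by (auto simp: is_initial_def intro: finite_subset)
  with is_initial_chain[OF assms(2,3)] show ?thesis
    by (auto simp: Un_absorb1 Un_absorb2 max.absorb1 max.absorb2 card_mono)
qed

lemma finite_mem_is_initial: "finite A \<Longrightarrow> is_initial A T \<Longrightarrow> t \<in> T \<Longrightarrow> finite t"
  by (auto simp: is_initial_def intro: finite_subset)

lemma closed_nbhd_is_initial_cases:
  assumes A: "finite A" and T: "is_initial A T" and w: "w \<in> closed_nbhd A T"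
  obtains (mem) "w \<in> T" | (insert) i t where "t \<in> T" "i \<notin> t" "w = insert i t"
proof (cases "w \<in> T")
  case False
  then obtain i where i: "i \<in> A" "toggle i w \<in> T"
    using w by (auto simp: closed_nbhd_def)
  have "i \<notin> w \<Longrightarrow> w \<prec> toggle i w"
    using finite_mem_is_initial[OF A T i(2)]
    by (intro simplicial_less_if_card_less) (auto simp: toggle_def)
  moreover have "w \<in> Pow A"
    using w T closed_nbhd_subset_Pow by (auto simp: is_initial_def)
  ultimately have "i \<in> w"
    using i False is_initialD[OF T] simplicial_less_asym by metis
  then show thesis
    using insert[OF i(2), of i] by (auto simp: toggle_def)
qed (use mem in blast)

lemma is_initial_insert_closed_nbhd:
  assumes A: "finite A" and T: "is_initial A T" and t: "t \<in> T" "i \<notin> t"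
    and z: "z \<in> Pow A" and less: "\<not> insert i t \<prec> z"
  shows "z \<in> closed_nbhd A T"
proof (cases "z = {}")
  case True
  have "\<not> t \<prec> z"
    using finite_mem_is_initial[OF A T t(1)] True by (auto simp: simplicial_less_def)
  then show ?thesis
    using is_initialD[OF T t(1) z] subset_closed_nbhd by auto
next
  case False
  define M where "M = Max z"
  have "finite z"
    using z A finite_subset by auto
  then have M: "M \<in> z" "j \<in> z - {M} \<Longrightarrow> j < M" for j
    using False by (auto simp: M_def less_le)
  then have "\<not> t \<prec> z - {M}"
    using insert_simplicial_less_insert_top[of t "z - {M}" i M] finite_mem_is_initial[OF A T t(1)]
      \<open>finite z\<close> t(2) less by (auto simp: insert_absorb)
  then have "z - {M} \<in> T"
    using is_initialD[OF T t(1), of "z - {M}"] z by auto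
  then show ?thesis
    using insert_in_closed_nbhd[of "z - {M}" T M A] M z by (auto simp: insert_absorb)
qed

lemma is_initial_closed_nbhd:
  assumes A: "finite A" and T: "is_initial A T"
  shows "is_initial A (closed_nbhd A T)"
proof -
  have "z \<in> closed_nbhd A T" if w: "w \<in> closed_nbhd A T" and z: "z \<in> Pow A" "\<not> w \<prec> z" for w z
    using A T w
  proof (cases rule: closed_nbhd_is_initial_cases)
    case mem
    then show ?thesis
      using is_initialD[OF T] z subset_closed_nbhd by blast
  next
    case (insert i t)
    then show ?thesis
      using is_initial_insert_closed_nbhd[OF A T] z by blast
  qed
  moreover have "closed_nbhd A T \<subseteq> Pow A"
    using T closed_nbhd_subset_Pow by (auto simp: is_initial_def)
  ultimately show ?thesis
    by (auto simp: is_initial_def)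
qed

section \<open>Compressions and Harper's theorem\<close>

definition lower_section :: "'a \<Rightarrow> 'a set set \<Rightarrow> 'a set set" where
  "lower_section i S = {x \<in> S. i \<notin> x}"

definition upper_section :: "'a \<Rightarrow> 'a set set \<Rightarrow> 'a set set" where
  "upper_section i S = {x. i \<notin> x \<and> insert i x \<in> S}"

lemma sections_Un: "lower_section i S \<union> insert i ` upper_section i S = S"
proof (intro subset_antisym subsetI)
  fix x assume x: "x \<in> S"
  show "x \<in> lower_section i S \<union> insert i ` upper_section i S"
  proof (cases "i \<in> x")
    case True
    then have "insert i (x - {i}) = x" "x - {i} \<in> upper_section i S"
      using x by (auto simp: upper_section_def insert_absorb)
    then show ?thesis
      by (metis UnI2 imageI)
  qed (use x in \<open>simp add: lower_section_def\<close>)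
qed (auto simp: lower_section_def upper_section_def)

lemma sections_subset_Pow:
  assumes "S \<subseteq> Pow A"
  shows "lower_section i S \<subseteq> Pow (A - {i})" "upper_section i S \<subseteq> Pow (A - {i})"
  using assms by (auto simp: lower_section_def upper_section_def)

lemma inj_on_insert_upper_section: "inj_on (insert i) (upper_section i S)"
  by (auto simp: inj_on_def upper_section_def)

lemma sum_sections:
  fixes f :: "'a set \<Rightarrow> nat"
  assumes "finite S"
  shows "sum f S = sum f (lower_section i S) + (\<Sum>x\<in>upper_section i S. f (insert i x))"
proof -
  have "finite (lower_section i S)" "finite (insert i ` upper_section i S)"
    using assms sections_Un[of i S] by (metis finite_Un)+
  moreover have "lower_section i S \<inter> insert i ` upper_section i S = {}"
    by (auto simp: lower_section_def)
  ultimately have "sum f S = sum f (lower_section i S) + sum f (insert i ` upper_section i S)"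
    using sum.union_disjoint sections_Un[of i S] by metis
  then show ?thesis
    using sum.reindex[OF inj_on_insert_upper_section, of f i S] by (simp add: comp_def)
qed

lemma card_sections:
  "finite S \<Longrightarrow> card S = card (lower_section i S) + card (upper_section i S)"
  using sum_sections[of S "\<lambda>_. 1" i] by simp

lemma lower_section_closed_nbhd_insert:
  assumes "i \<notin> B"
  shows "lower_section i (closed_nbhd (insert i B) S)
    = closed_nbhd B (lower_section i S) \<union> upper_section i S"
proof (rule set_eqI)
  fix x
  have "i \<noteq> j" if "j \<in> B" for j
    using that assms by blast
  then have "x \<in> closed_nbhd B (lower_section i S) \<longleftrightarrow> i \<notin> x \<and> x \<in> closed_nbhd B S"
    by (auto simp: closed_nbhd_def lower_section_def mem_toggle_iff)
  moreover have "x \<in> lower_section i (closed_nbhd (insert i B) S) \<longleftrightarrow>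
      i \<notin> x \<and> (x \<in> closed_nbhd B S \<or> toggle i x \<in> S)"
    by (auto simp: closed_nbhd_def lower_section_def)
  moreover have "x \<in> upper_section i S \<longleftrightarrow> i \<notin> x \<and> toggle i x \<in> S"
    by (auto simp: upper_section_def toggle_def)
  ultimately show "x \<in> lower_section i (closed_nbhd (insert i B) S) \<longleftrightarrow>
      x \<in> closed_nbhd B (lower_section i S) \<union> upper_section i S"
    by blast
qed

lemma upper_section_closed_nbhd_insert:
  assumes "i \<notin> B"
  shows "upper_section i (closed_nbhd (insert i B) S)
    = closed_nbhd B (upper_section i S) \<union> lower_section i S"
proof (rule set_eqI)
  fix x
  have "i \<noteq> j" "toggle j (insert i x) = insert i (toggle j x)" if "j \<in> B" for j
    using that assms by (auto simp: mem_toggle_iff)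
  then have "x \<in> closed_nbhd B (upper_section i S) \<longleftrightarrow> i \<notin> x \<and> insert i x \<in> closed_nbhd B S"
    by (auto simp: closed_nbhd_def upper_section_def mem_toggle_iff)
  moreover have "x \<in> upper_section i (closed_nbhd (insert i B) S) \<longleftrightarrow>
      i \<notin> x \<and> (insert i x \<in> closed_nbhd B S \<or> toggle i (insert i x) \<in> S)"
    by (auto simp: closed_nbhd_def upper_section_def)
  moreover have "x \<in> lower_section i S \<longleftrightarrow> i \<notin> x \<and> toggle i (insert i x) \<in> S"
    by (auto simp: lower_section_def toggle_def)
  ultimately show "x \<in> upper_section i (closed_nbhd (insert i B) S) \<longleftrightarrow>
      x \<in> closed_nbhd B (upper_section i S) \<union> lower_section i S"
    by blast
qed

lemma card_closed_nbhd_sections: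
  assumes "finite A" "S \<subseteq> Pow A" "i \<in> A"
  shows "card (closed_nbhd A S)
    = card (closed_nbhd (A - {i}) (lower_section i S) \<union> upper_section i S)
      + card (closed_nbhd (A - {i}) (upper_section i S) \<union> lower_section i S)"
  using card_sections[OF finite_closed_nbhd[OF assms(1,2)], of i]
    lower_section_closed_nbhd_insert[of i "A - {i}" S]
    upper_section_closed_nbhd_insert[of i "A - {i}" S]
  by (simp add: insert_absorb[OF assms(3)])

definition compress :: "'a::wellorder set \<Rightarrow> 'a \<Rightarrow> 'a set set \<Rightarrow> 'a set set" where
  "compress A i S = initial_segment (A - {i}) (card (lower_section i S))
     \<union> insert i ` initial_segment (A - {i}) (card (upper_section i S))"

lemma notin_initial_segment: "x \<in> initial_segment (A - {i}) s \<Longrightarrow> i \<notin> x"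
  by (auto simp: initial_segment_def)

lemma lower_section_compress:
  "lower_section i (compress A i S) = initial_segment (A - {i}) (card (lower_section i S))"
  by (auto simp: lower_section_def compress_def dest: notin_initial_segment)

lemma upper_section_compress:
  "upper_section i (compress A i S) = initial_segment (A - {i}) (card (upper_section i S))"
  by (auto simp: upper_section_def compress_def dest: notin_initial_segment)
    (metis insert_ident notin_initial_segment)

lemmas sections_compress = lower_section_compress upper_section_compress

lemma compress_subset_Pow: "i \<in> A \<Longrightarrow> compress A i S \<subseteq> Pow A"
  by (auto simp: compress_def initial_segment_def)

lemma card_compress:
  assumes "finite A" "S \<subseteq> Pow A" "i \<in> A"
  shows "card (compress A i S) = card S"
proof -
  have "finite S" "finite (compress A i S)"
    using assms compress_subset_Pow by (meson finite_Pow_iff finite_subset)+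
  moreover have "card (initial_segment (A - {i}) (card V)) = card V" if "V \<subseteq> Pow (A - {i})" for V
    using assms(1) that by (intro card_initial_segment card_le_of_subset_Pow) auto
  ultimately show ?thesis
    using sections_subset_Pow[OF assms(2)]
    by (simp add: card_sections[of S i] card_sections[of "compress A i S" i] sections_compress)
qed

lemma sum_less_if_all_less:
  fixes f :: "'a \<Rightarrow> nat"
  assumes "finite X" "finite Y" "card X = card Y" "X \<noteq> {}"
    and "\<And>x y. x \<in> X \<Longrightarrow> y \<in> Y \<Longrightarrow> f x < f y"
  shows "sum f X < sum f Y"
proof -
  obtain g where g: "bij_betw g X Y"
    using assms finite_same_card_bij by blast
  have "sum f X < sum (\<lambda>x. f (g x)) X"
    using assms g by (intro sum_strict_mono) (auto dest: bij_betwE)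
  also have "\<dots> = sum f Y"
    using g by (rule sum.reindex_bij_betw)
  finally show ?thesis .
qed

lemma sum_initial_segment_less:
  fixes f :: "'a::wellorder set \<Rightarrow> nat"
  assumes B: "finite B" and U: "U \<subseteq> Pow B" "U \<noteq> initial_segment B (card U)"
    and f: "\<And>x y. x \<in> Pow B \<Longrightarrow> y \<in> Pow B \<Longrightarrow> x \<prec> y \<Longrightarrow> f x < f y"
  shows "sum f (initial_segment B (card U)) < sum f U"
proof -
  let ?T = "initial_segment B (card U)"
  have fin: "finite U" "finite ?T"
    using B U finite_subset by auto
  have card_T: "card ?T = card U"
    by (rule card_initial_segment[OF B card_le_of_subset_Pow[OF B U(1)]])
  have "sum f (?T - U) < sum f (U - ?T)"
  proof (rule sum_less_if_all_less)
    show "card (?T - U) = card (U - ?T)"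
      using fin card_T by (intro le_antisym card_le_sym_Diff) auto
    show "?T - U \<noteq> {}"
      using fin card_T U(2) card_subset_eq[of U ?T] by auto
    show "f x < f y" if "x \<in> ?T - U" "y \<in> U - ?T" for x y
      using that U(1) is_initial_initial_segment[OF B, of "card U"]
      by (intro f) (auto simp: is_initial_def)
  qed (use fin in auto)
  moreover have "sum f ?T = sum f (?T - U) + sum f (?T \<inter> U)"
    "sum f U = sum f (U - ?T) + sum f (?T \<inter> U)"
    using fin by (metis sum.Int_Diff add.commute, metis sum.Int_Diff add.commute inf_commute)
  ultimately show ?thesis
    by simp
qed

lemma sum_rank_compress_less:
  assumes A: "finite A" and S: "S \<subseteq> Pow A" and i: "i \<in> A" and neq: "compress A i S \<noteq> S"
  shows "sum (rank A) (compress A i S) < sum (rank A) S"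
proof -
  let ?B = "A - {i}" and ?L = "lower_section i S" and ?U = "upper_section i S"
  let ?f = "\<lambda>x. rank A (insert i x)"
  have fin: "finite S" "finite (compress A i S)"
    using assms compress_subset_Pow by (meson finite_Pow_iff finite_subset)+
  have B: "finite ?B"
    using A by simp
  have lower: "sum (rank A) (initial_segment ?B (card ?L)) < sum (rank A) ?L"
    if "?L \<noteq> initial_segment ?B (card ?L)"
    using rank_less_rank[OF A]
    by (intro sum_initial_segment_less[OF B sections_subset_Pow(1)[OF S] that]) auto
  have upper: "sum ?f (initial_segment ?B (card ?U)) < sum ?f ?U"
    if "?U \<noteq> initial_segment ?B (card ?U)"
  proof (rule sum_initial_segment_less[OF B sections_subset_Pow(2)[OF S] that])
    fix x y assume xy: "x \<in> Pow ?B" "y \<in> Pow ?B" "x \<prec> y"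
    then have "insert i x \<prec> insert i y"
      using B by (subst insert_simplicial_less_insert_iff) (auto intro: finite_subset)
    then show "?f x < ?f y"
      using xy i by (intro rank_less_rank[OF A]) auto
  qed
  have "?L \<noteq> initial_segment ?B (card ?L) \<or> ?U \<noteq> initial_segment ?B (card ?U)"
    using neq sections_Un[of i S] unfolding compress_def by auto
  then have "sum (rank A) (initial_segment ?B (card ?L)) + sum ?f (initial_segment ?B (card ?U))
      < sum (rank A) ?L + sum ?f ?U"
    using lower upper by fastforce
  then show ?thesis
    using sum_sections[OF fin(1), of "rank A" i] sum_sections[OF fin(2), of "rank A" i]
    by (simp add: sections_compress)
qed

lemma is_initial_sections_if_compressed:
  assumes "finite A" "compress A i S = S"
  shows "is_initial (A - {i}) (lower_section i S)" "is_initial (A - {i}) (upper_section i S)"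
  using assms sections_compress[of i A S] is_initial_initial_segment
  by (metis finite_Diff)+

lemma compressed_inversion_complement:
  assumes A: "finite A" and compressed: "\<forall>i\<in>A. compress A i S = S"
    and x: "x \<in> Pow A - S" and y: "y \<in> S" "y \<in> Pow A" and xy: "x \<prec> y"
  shows "y = A - x"
proof -
  have "i \<in> x \<longleftrightarrow> i \<notin> y" if i: "i \<in> A" for i
  proof (rule ccontr)
    assume same: "\<not> ?thesis"
    note initial_sections = is_initial_sections_if_compressed[OF A bspec[OF compressed i]]
    have not_less: "\<not> y \<prec> x"
      by (rule simplicial_less_asym[OF xy])
    consider "i \<in> x" "i \<in> y" | "i \<notin> x" "i \<notin> y"
      using same by blast
    then show False
    proof cases
      case 1
      then have ins: "insert i (x - {i}) = x" "insert i (y - {i}) = y"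
        by auto
      then have "\<not> y - {i} \<prec> x - {i}"
        using insert_simplicial_less_insert_iff[of "y - {i}" "x - {i}" i] not_less A x y
        by (auto intro: finite_subset)
      moreover have "y - {i} \<in> upper_section i S" "x - {i} \<in> Pow (A - {i})"
        using ins x y by (auto simp: upper_section_def)
      ultimately have "x - {i} \<in> upper_section i S"
        using is_initialD[OF initial_sections(2)] by blast
      then show False
        using x ins by (simp add: upper_section_def)
    next
      case 2
      then have "y \<in> lower_section i S" "x \<in> Pow (A - {i})"
        using x y by (auto simp: lower_section_def)
      then have "x \<in> lower_section i S"
        using is_initialD[OF initial_sections(1)] not_less by blast
      then show False
        using x by (simp add: lower_section_def)
    qed
  qed
  then show ?thesis
    using x y by auto
qed

lemma compressed_cases:
  assumes A: "finite A" and S: "S \<subseteq> Pow A" and compressed: "\<forall>i\<in>A. compress A i S = S"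
  obtains (initial) "is_initial A S"
    | (gap) x where "x \<in> Pow A" "x \<prec> A - x" "\<forall>z\<in>Pow A. \<not> (x \<prec> z \<and> z \<prec> A - x)"
        "S = insert (A - x) {z \<in> Pow A. z \<prec> x}"
proof (cases "is_initial A S")
  case False
  have inversion: "v = A - u" if "u \<in> Pow A - S" "v \<in> S" "u \<prec> v" for u v
    using compressed_inversion_complement[OF A compressed that(1,2) _ that(3)] that S by auto
  obtain x y where x: "x \<in> Pow A - S" and y: "y \<in> S" and "\<not> y \<prec> x"
    using False S by (auto simp: is_initial_def)
  then have xy: "x \<prec> y"
    using simplicial_less_linear[of x y] by auto
  have y_eq: "y = A - x"
    by (rule inversion[OF x y xy])
  have below: "u = x" if "u \<in> Pow A - S" "u \<prec> y" for u
    using inversion[OF that(1) y that(2)] y_eq x that(1) by auto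
  have above: "v = y" if "v \<in> S" "x \<prec> v" for v
    using inversion[OF x that] y_eq by simp
  have "\<not> (x \<prec> z \<and> z \<prec> A - x)" if "z \<in> Pow A" for z
    using above[of z] below[of z] that y_eq by (cases "z \<in> S") auto
  moreover have "S = insert (A - x) {z \<in> Pow A. z \<prec> x}"
  proof (intro set_eqI iffI)
    fix z assume "z \<in> S"
    then show "z \<in> insert (A - x) {z \<in> Pow A. z \<prec> x}"
      using above[of z] y_eq x S simplicial_less_linear[of x z] by auto
  next
    fix z assume "z \<in> insert (A - x) {z \<in> Pow A. z \<prec> x}"
    then show "z \<in> S"
      using y y_eq below[of z] simplicial_less_trans[OF _ xy, of z] by (cases "z \<in> S") auto
  qed
  ultimately show thesis
    using gap[of x] x xy y_eq by auto
qed (use initial in blast)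

lemma closed_nbhd_singleton_subset_if_Max_mem:
  assumes x: "finite x" "x \<in> Pow A" and M: "M \<in> x" "\<forall>j\<in>A. j \<le> M"
  shows "closed_nbhd A {x} \<subseteq> closed_nbhd A {z \<in> Pow A. z \<prec> x}" (is "_ \<subseteq> closed_nbhd A ?U")
proof
  have delete: "x - {i} \<in> ?U" if "i \<in> x" for i
    using x that by (auto intro!: simplicial_less_if_card_less card_Diff1_less)
  fix w assume "w \<in> closed_nbhd A {x}"
  then obtain i where "w = x \<or> i \<in> A \<and> w = toggle i x"
    by (auto simp: closed_nbhd_def) (metis toggle_toggle)
  then consider "w = x" | "i \<in> x" "w = x - {i}" | "i \<in> A" "i \<notin> x" "w = insert i x"
    by (auto simp: toggle_def split: if_splits)
  then show "w \<in> closed_nbhd A ?U"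
  proof cases
    case 1
    then show ?thesis
      using insert_in_closed_nbhd[OF delete[OF M(1)], of M A] M(1) x by (auto simp: insert_absorb)
  next
    case 2
    then show ?thesis
      using delete subset_closed_nbhd by blast
  next
    case 3
    have "insert i (x - {M}) \<prec> insert M (insert i (x - {M}) - {i})"
      using x 3 M by (intro simplicial_less_exchange) (auto simp: less_le)
    moreover have "insert M (insert i (x - {M}) - {i}) = x"
      using 3 M(1) by auto
    ultimately have "insert i (x - {M}) \<in> ?U"
      using 3 x by auto
    then have "insert M (insert i (x - {M})) \<in> closed_nbhd A ?U"
      using M(1) x by (intro insert_in_closed_nbhd) auto
    then show ?thesis
      using 3 M(1) by (simp add: insert_commute[of M i] insert_absorb)
  qed
qed

lemma eq_singleton_if_exchange_beyond_complement:
  assumes A: "finite A" and x: "x \<in> Pow A" "x \<noteq> {}" and less: "x \<prec> A - x"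
    and M: "M \<in> A - x"
    and beyond: "\<And>j. j \<in> x \<Longrightarrow> \<not> insert M (x - {j}) \<prec> A - x"
  shows "\<exists>m. x = {m} \<and> A - x = {M}"
proof -
  have "finite x"
    using A x finite_subset by auto
  then have card_exchange: "card (insert M (x - {j})) = card x" if "j \<in> x" for j
    using that M card_Suc_Diff1[of x j] by (simp del: card_Diff_insert)
  have "card (A - x) \<le> card x"
    using x(2) beyond card_exchange simplicial_less_if_card_less by (metis all_not_in_conv not_le)
  with less obtain m where m: "card x = card (A - x)" "m \<in> x" "\<forall>j<m. j \<in> x \<longleftrightarrow> j \<in> A - x"
    by (auto simp: simplicial_less_def)
  have "j = m" if j: "j \<in> x" for j
  proof (rule ccontr)
    assume "j \<noteq> m"
    then have "insert M (x - {j}) \<prec> A - x"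
      using m x M by (intro simplicial_lessI[of _ _ m]) (auto simp: card_exchange[OF j])
    then show False
      using beyond[OF j] by simp
  qed
  then have "x = {m}"
    using m(2) by blast
  moreover from this have "card (A - x) = 1"
    using m(1) by simp
  then have "A - x = {M}"
    using M by (metis card_1_singletonE singletonD)
  ultimately show ?thesis
    by blast
qed

lemma complement_eq_singleton_if_successor:
  assumes A: "finite A" and x: "x \<in> Pow A" and less: "x \<prec> A - x"
    and succ: "\<forall>z\<in>Pow A. \<not> (x \<prec> z \<and> z \<prec> A - x)"
    and M: "M \<in> A - x" "\<forall>j\<in>A. j \<le> M"
  shows "A - x = {M}" and "x = {} \<or> (\<exists>m. x = {m})"
proof -
  have beyond: "\<not> z \<prec> A - x" if "x \<prec> z" "z \<in> Pow A" for z
    using succ that by blast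
  have "A - x = {M} \<and> (x = {} \<or> (\<exists>m. x = {m}))"
  proof (cases "x = {}")
    case True
    then have "\<not> {M} \<prec> A - x"
      using M by (intro beyond) (auto intro: simplicial_less_if_card_less)
    then have "card (A - x) \<le> 1"
      using simplicial_less_if_card_less[of "{M}" "A - x"] by fastforce
    then show ?thesis
      using M True A by (auto simp: card_le_Suc0_iff_eq)
  next
    case False
    have "\<not> insert M (x - {j}) \<prec> A - x" if "j \<in> x" for j
    proof (rule beyond)
      show "x \<prec> insert M (x - {j})"
        using that x M A
        by (intro simplicial_less_exchange) (auto simp: less_le intro: finite_subset)
    qed (use M x in auto)
    from eq_singleton_if_exchange_beyond_complement[OF A x False less M(1) this] show ?thesis
      by blast
  qed
  then show "A - x = {M}" "x = {} \<or> (\<exists>m. x = {m})"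
    by simp_all
qed

lemma Pow_subset_closed_nbhd_complement:
  assumes "A - x = {M}" "x = {} \<or> (\<exists>m. x = {m})" "x \<in> Pow A"
  shows "Pow A \<subseteq> closed_nbhd A (insert (A - x) {z \<in> Pow A. z \<prec> x})"
proof -
  have A_eq: "A = insert M x" and "M \<notin> x"
    using assms by auto
  from assms(2) show ?thesis
  proof (elim disjE exE)
    assume "x = {}"
    then show ?thesis
      unfolding assms(1) unfolding A_eq by (auto simp: closed_nbhd_def toggle_def)
  next
    fix m assume "x = {m}"
    moreover from this have "{} \<in> {z \<in> Pow A. z \<prec> x}"
      by (auto intro: simplicial_less_if_card_less)
    ultimately show ?thesis
      unfolding assms(1) unfolding A_eq using \<open>M \<notin> x\<close>
      by (auto simp: closed_nbhd_def toggle_def Pow_insert)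
  qed
qed

lemma card_closed_nbhd_complement_successor:
  assumes A: "finite A" and x: "x \<in> Pow A" and less: "x \<prec> A - x"
    and succ: "\<forall>z\<in>Pow A. \<not> (x \<prec> z \<and> z \<prec> A - x)"
  defines "U \<equiv> {z \<in> Pow A. z \<prec> x}"
  shows "card (closed_nbhd A (insert x U)) \<le> card (closed_nbhd A (insert (A - x) U))"
proof -
  have "A \<noteq> {}"
    using less x by auto
  define M where "M = Max A"
  have M: "M \<in> A" "\<forall>j\<in>A. j \<le> M"
    using A \<open>A \<noteq> {}\<close> by (auto simp: M_def)
  have subset: "closed_nbhd A (insert x U) \<subseteq> Pow A" "closed_nbhd A (insert (A - x) U) \<subseteq> Pow A"
    using x by (intro closed_nbhd_subset_Pow; auto simp: U_def)+
  have "closed_nbhd A (insert x U) \<subseteq> closed_nbhd A (insert (A - x) U)"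
  proof (cases "M \<in> x")
    case True
    have "finite x"
      using A x finite_subset by auto
    from closed_nbhd_singleton_subset_if_Max_mem[OF this x True M(2)] show ?thesis
      using closed_nbhd_Un[of A "{x}" U] closed_nbhd_Un[of A "{A - x}" U] by (auto simp: U_def)
  next
    case False
    then have "M \<in> A - x"
      using M(1) by simp
    from complement_eq_singleton_if_successor[OF A x less succ this M(2)]
    have "Pow A \<subseteq> closed_nbhd A (insert (A - x) U)"
      unfolding U_def by (rule Pow_subset_closed_nbhd_complement) (rule x)
    then show ?thesis
      using subset(1) by blast
  qed
  then show ?thesis
    using finite_subset[OF subset(2)] A by (intro card_mono) auto
qed

lemma card_closed_nbhd_initial_segment_le_if_compressed:
  assumes A: "finite A" and S: "S \<subseteq> Pow A" and compressed: "\<forall>i\<in>A. compress A i S = S"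
  shows "card (closed_nbhd A (initial_segment A (card S))) \<le> card (closed_nbhd A S)"
  using A S compressed
proof (cases rule: compressed_cases)
  case initial
  then show ?thesis
    using is_initial_eq_initial_segment[OF A] by simp
next
  case (gap x)
  let ?U = "{z \<in> Pow A. z \<prec> x}"
  have "u \<prec> z" if "u \<in> insert x ?U" "z \<in> Pow A - insert x ?U" for u z
    using that simplicial_less_linear[of x z] simplicial_less_trans[of u x z] by auto
  then have "is_initial A (insert x ?U)"
    using gap(1) by (auto simp: is_initial_def)
  moreover have "card (insert x ?U) = card S"
    using A simplicial_less_asym[OF gap(2)] by (simp add: gap(4))
  ultimately have "initial_segment A (card S) = insert x ?U"
    using is_initial_eq_initial_segment[OF A] by metis
  then show ?thesis
    using card_closed_nbhd_complement_successor[OF A gap(1-3)] gap(4) by simp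
qed

lemma card_closed_nbhd_compress_le:
  assumes A: "finite A" and S: "S \<subseteq> Pow A" and i: "i \<in> A"
    and isoperimetric: "\<And>V. V \<subseteq> Pow (A - {i}) \<Longrightarrow>
      card (closed_nbhd (A - {i}) (initial_segment (A - {i}) (card V)))
        \<le> card (closed_nbhd (A - {i}) V)"
  shows "card (closed_nbhd A (compress A i S)) \<le> card (closed_nbhd A S)"
proof -
  let ?B = "A - {i}" and ?I = "\<lambda>V. initial_segment (A - {i}) (card V)"
  have B: "finite ?B"
    using A by simp
  have half: "card (closed_nbhd ?B (?I V) \<union> ?I W) \<le> card (closed_nbhd ?B V \<union> W)"
    if V: "V \<subseteq> Pow ?B" and W: "W \<subseteq> Pow ?B" for V W
  proof -
    have "card (closed_nbhd ?B (?I V) \<union> ?I W) = max (card (closed_nbhd ?B (?I V))) (card (?I W))"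
      using B by (intro card_Un_is_initial[of ?B] is_initial_closed_nbhd is_initial_initial_segment)
    also have "\<dots> \<le> max (card (closed_nbhd ?B V)) (card W)"
      using isoperimetric[OF V] card_initial_segment[OF B card_le_of_subset_Pow[OF B W]] by simp
    also have "\<dots> \<le> card (closed_nbhd ?B V \<union> W)"
      using finite_closed_nbhd[OF B V] finite_subset[OF W] B by (auto intro!: card_mono)
    finally show ?thesis .
  qed
  show ?thesis
    using half[OF sections_subset_Pow[OF S]] half[OF sections_subset_Pow(2,1)[OF S]]
      card_closed_nbhd_sections[OF A S i]
      card_closed_nbhd_sections[OF A compress_subset_Pow[OF i] i, of S]
    by (simp add: sections_compress)
qed

theorem Harper_vertex_isoperimetric:
  assumes "finite A" "S \<subseteq> Pow A"
  shows "card (closed_nbhd A (initial_segment A (card S))) \<le> card (closed_nbhd A S)"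
  using assms
proof (induction "card A" arbitrary: A S rule: less_induct)
  case (less A)
  note A = less.prems(1)
  have smaller: "finite (A - {i})" "card (A - {i}) < card A" if "i \<in> A" for i
    using A that by (auto intro: card_Diff1_less simp del: card_Diff_insert)
  show ?case
    using less.prems(2)
  proof (induction "sum (rank A) S" arbitrary: S rule: less_induct)
    case inner: (less S)
    note S = inner.prems
    show ?case
    proof (cases "\<forall>i\<in>A. compress A i S = S")
      case True
      then show ?thesis
        using card_closed_nbhd_initial_segment_le_if_compressed[OF A S] by blast
    next
      case False
      then obtain i where i: "i \<in> A" and neq: "compress A i S \<noteq> S"
        by blast
      have "card (closed_nbhd A (initial_segment A (card S)))
          \<le> card (closed_nbhd A (compress A i S))"
        using inner.hyps[OF sum_rank_compress_less[OF A S i neq] compress_subset_Pow[OF i]]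
        by (simp add: card_compress[OF A S i])
      also have "\<dots> \<le> card (closed_nbhd A S)"
        using less.hyps[OF smaller(2,1)[OF i]] by (intro card_closed_nbhd_compress_le[OF A S i])
      finally show ?thesis .
    qed
  qed
qed

section \<open>Rank differences along edges\<close>

definition small_subsets :: "'a set \<Rightarrow> nat \<Rightarrow> nat" where
  "small_subsets B r = card {z \<in> Pow B. card z < r}"

lemma small_subsets_0 [simp]: "small_subsets B 0 = 0"
  by (simp add: small_subsets_def)

lemma small_subsets_Suc:
  assumes "finite B"
  shows "small_subsets B (Suc r) = small_subsets B r + (card B choose r)"
proof -
  have "{z \<in> Pow B. card z < Suc r} = {z \<in> Pow B. card z < r} \<union> {z. z \<subseteq> B \<and> card z = r}"
    by auto
  then have "small_subsets B (Suc r) = small_subsets B r + card {z. z \<subseteq> B \<and> card z = r}"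
    unfolding small_subsets_def using assms by (subst card_Un_disjoint[symmetric]) auto
  then show ?thesis
    using n_subsets[OF assms] by simp
qed

lemma rank_insert_min:
  assumes B: "finite B" "\<forall>j\<in>B. a < j" and x: "x \<subseteq> insert a B"
  shows "rank (insert a B) x = rank B (x - {a}) + small_subsets B (card x)"
proof -
  let ?R = "{z \<in> Pow (insert a B). z \<prec> x}"
  have sub: "finite z" "a \<notin> z" "\<forall>j\<in>z. a < j" if "z \<subseteq> B" for z
    using that B by (auto intro: finite_subset)
  have split: "rank (insert a B) x = card (lower_section a ?R) + card (upper_section a ?R)"
    unfolding rank_def using B(1) by (intro card_sections) auto
  show ?thesis
  proof (cases "a \<in> x")
    case True
    define y where "y = x - {a}"
    then have y: "y \<subseteq> B" "x = insert a y"
      using x True by auto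
    have less_iff: "z \<prec> x \<longleftrightarrow> card z < Suc (card y)" "insert a z \<prec> x \<longleftrightarrow> z \<prec> y" if "z \<subseteq> B" for z
      using insert_min_simplicial_less_iff(2)[of z y a] insert_simplicial_less_insert_iff[of z y a]
        sub[OF that] sub[OF y(1)] by (simp_all add: y(2) less_Suc_eq_le)
    have "lower_section a ?R = {z \<in> Pow B. card z < Suc (card y)}"
      "upper_section a ?R = {z \<in> Pow B. z \<prec> y}"
      using sub(2) less_iff by (auto simp: lower_section_def upper_section_def subset_insert)
    then show ?thesis
      using split sub[OF y(1)] unfolding y(2) by (simp add: rank_def small_subsets_def)
  next
    case False
    then have "x \<subseteq> B"
      using x by auto
    then have less_iff: "insert a z \<prec> x \<longleftrightarrow> card z < card x" if "z \<subseteq> B" for z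
      using insert_min_simplicial_less_iff(1)[of z x a] sub that by simp
    have "lower_section a ?R = {z \<in> Pow B. z \<prec> x}"
      "upper_section a ?R = {z \<in> Pow B. card z < card x}"
      using sub(2) less_iff by (auto simp: lower_section_def upper_section_def subset_insert)
    then show ?thesis
      using split False by (simp add: rank_def small_subsets_def)
  qed
qed

lemma rank_insert_insert_min:
  assumes B: "finite B" "\<forall>j\<in>B. a < j" and x: "x \<subseteq> insert a B" and i: "i \<in> insert a B" "i \<notin> x"
  shows "rank (insert a B) (insert i x) + rank B (x - {a})
    = rank (insert a B) x + rank B (insert i x - {a}) + (card B choose card x)"
proof -
  have "finite x"
    using x B(1) finite_subset by blast
  then have "card (insert i x) = Suc (card x)"
    using i(2) by simp
  then show ?thesis
    using rank_insert_min[OF B x] rank_insert_min[OF B, of "insert i x"] x i(1)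
    by (simp add: small_subsets_Suc[OF B(1)])
qed

definition central_sum :: "nat \<Rightarrow> nat" where
  "central_sum d = (\<Sum>m<d. m choose (m div 2))"

lemma central_sum_0 [simp]: "central_sum 0 = 0"
  by (simp add: central_sum_def)

lemma central_sum_Suc [simp]: "central_sum (Suc d) = central_sum d + (d choose (d div 2))"
  by (simp add: central_sum_def)

lemma central_sum_less: "central_sum d < 2 ^ d"
proof (induction d)
  case (Suc d)
  then show ?case
    using binomial_le_pow2[of d "d div 2"] by simp
qed simp

lemma rank_insert_le:
  assumes "finite A" "x \<subseteq> A" "i \<in> A"
  shows "rank A (insert i x) \<le> rank A x + central_sum (card A)"
  using assms
proof (induction A arbitrary: x rule: finite_linorder_min_induct)
  case (insert a B)
  have card_A: "central_sum (card (insert a B))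
      = central_sum (card B) + (card B choose (card B div 2))"
    using insert.hyps by (subst card_insert_disjoint) auto
  show ?case
  proof (cases "i \<in> x")
    case True
    then show ?thesis
      by (simp add: insert_absorb)
  next
    case False
    have "rank B (insert i x - {a}) \<le> rank B (x - {a}) + central_sum (card B)"
    proof (cases "i = a")
      case False
      then have "insert i x - {a} = insert i (x - {a})"
        by auto
      then show ?thesis
        using insert.IH[of "x - {a}"] insert.prems False by auto
    qed simp
    then show ?thesis
      using rank_insert_insert_min[OF insert.hyps(1,2) insert.prems False]
        binomial_maximum[of "card B" "card x"] unfolding card_A by linarith
  qed
qed simp

lemma rank_insert_eq_ex:
  assumes "finite A" "A \<noteq> {}"
  shows "\<exists>x i. x \<subseteq> A \<and> i \<in> A \<and> i \<notin> x \<and> card x = (card A - 1) div 2 \<and>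
    rank A (insert i x) = rank A x + central_sum (card A)"
  using assms
proof (induction A rule: finite_linorder_min_induct)
  case (insert a B)
  have aB: "a \<notin> B"
    using insert.hyps by auto
  have "\<exists>x i. x \<subseteq> insert a B \<and> i \<in> insert a B \<and> i \<notin> x \<and> card x = card B div 2 \<and>
      rank B (insert i x - {a}) = rank B (x - {a}) + central_sum (card B)"
  proof (cases "B = {}")
    case True
    then show ?thesis
      by (intro exI[of _ "{}"] exI[of _ a]) auto
  next
    case False
    then obtain x i where x: "x \<subseteq> B" "i \<in> B" "i \<notin> x" "card x = (card B - 1) div 2"
      "rank B (insert i x) = rank B x + central_sum (card B)"
      using insert.IH by blast
    define y where "y = (if card x = card B div 2 then x else insert a x)"
    have ax: "a \<notin> x" "finite x" "a \<noteq> i"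
      using x aB insert.hyps finite_subset by auto
    moreover have "0 < card B"
      using False insert.hyps by (simp add: card_gt_0_iff)
    then have "card x = card B div 2 \<or> Suc (card x) = card B div 2"
      using x(4) by linarith
    ultimately have "card y = card B div 2"
      by (auto simp: y_def)
    moreover have "y - {a} = x" "insert i y - {a} = insert i x" "y \<subseteq> insert a B" "i \<notin> y"
      using x ax by (auto simp: y_def)
    ultimately show ?thesis
      using x by (intro exI[of _ y] exI[of _ i]) auto
  qed
  then obtain x i where x: "x \<subseteq> insert a B" "i \<in> insert a B" "i \<notin> x" "card x = card B div 2"
    "rank B (insert i x - {a}) = rank B (x - {a}) + central_sum (card B)"
    by blast
  then show ?case
    using rank_insert_insert_min[OF insert.hyps(1,2) x(1-3)] aB insert.hyps(1)
    by (intro exI[of _ x] exI[of _ i]) simp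
qed simp

lemma card_closed_nbhd_gt_rank:
  assumes A: "finite A" and x: "x \<subseteq> A" and i: "i \<in> A"
    and S: "S \<subseteq> Pow A" "card S = Suc (rank A x)"
  shows "rank A (insert i x) < card (closed_nbhd A S)"
proof -
  let ?T = "closed_nbhd A (initial_segment A (card S))"
  have T: "is_initial A ?T"
    using A by (intro is_initial_closed_nbhd is_initial_initial_segment)
  then have "?T = initial_segment A (card ?T)"
    by (rule is_initial_eq_initial_segment[OF A])
  moreover have "insert i x \<in> ?T"
    using x i S by (intro insert_in_closed_nbhd) (auto simp: initial_segment_def)
  ultimately have "rank A (insert i x) < card ?T"
    unfolding initial_segment_def by blast
  then show ?thesis
    using Harper_vertex_isoperimetric[OF A S(1)] by simp
qed

lemma critical_size_ex:
  fixes A :: "'a::wellorder set"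
  assumes A: "finite A"
  shows "\<exists>s\<le>2 ^ card A. \<forall>S\<subseteq>Pow A. card S = s \<longrightarrow> s + central_sum (card A) \<le> card (closed_nbhd A S)"
proof (cases "A = {}")
  case True
  then show ?thesis
    by (intro exI[of _ 0]) auto
next
  case False
  then obtain x i where x: "x \<subseteq> A" "i \<in> A" "rank A (insert i x) = rank A x + central_sum (card A)"
    using rank_insert_eq_ex[OF A] by blast
  show ?thesis
  proof (intro exI[of _ "Suc (rank A x)"] conjI allI impI)
    show "Suc (rank A x) \<le> 2 ^ card A"
      using rank_less_card_Pow[OF A, of x] x by simp
    fix S assume "S \<subseteq> Pow A" "card S = Suc (rank A x)"
    then show "Suc (rank A x) + central_sum (card A) \<le> card (closed_nbhd A S)"
      using card_closed_nbhd_gt_rank[OF A x(1,2), of S] x(3) by simp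
  qed
qed

lemma rank_toggle_le:
  assumes "finite A" "x \<in> Pow A" "i \<in> A"
  shows "rank A (toggle i x) \<le> rank A x + central_sum (card A)"
proof (cases "i \<in> x")
  case True
  have "finite x"
    using assms finite_subset by auto
  then have "toggle i x \<prec> x"
    using True by (auto simp: toggle_def intro: simplicial_less_if_card_less card_Diff1_less)
  then show ?thesis
    using rank_less_rank[OF assms(1) toggle_in_Pow[OF assms(2,3)]]
    by (meson less_imp_le trans_le_add1)
qed (use assms rank_insert_le in \<open>auto simp: toggle_def\<close>)

section \<open>Parity classes and their projections\<close>

definition parity_class :: "'a set \<Rightarrow> bool \<Rightarrow> 'a set set" where
  "parity_class A b = {x \<in> Pow A. even (card x) \<longleftrightarrow> b}"

lemma toggle_in_parity_class:
  assumes "finite A" "i \<in> A" "x \<in> parity_class A b"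
  shows "toggle i x \<in> parity_class A (\<not> b)"
proof -
  have "finite x"
    using assms finite_subset by (auto simp: parity_class_def)
  then show ?thesis
    using assms toggle_in_Pow[of x A i] by (auto simp: parity_class_def even_card_toggle)
qed

lemma parity_class_disjoint: "x \<in> parity_class A b \<Longrightarrow> x \<notin> parity_class A (\<not> b)"
  by (simp add: parity_class_def)

lemma inj_on_project_parity_class:
  assumes "finite A" "a \<in> A"
  shows "inj_on (\<lambda>x. x - {a}) (parity_class A b)"
proof (rule inj_onI)
  fix x y assume xy: "x \<in> parity_class A b" "y \<in> parity_class A b" "x - {a} = y - {a}"
  then have "x \<noteq> toggle a y"
    using toggle_in_parity_class[OF assms] parity_class_disjoint by blast
  then show "x = y"
    using diff_singleton_eqD[OF xy(3)] by blast
qed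

lemma project_parity_class:
  assumes "finite A" "a \<in> A"
  shows "(\<lambda>x. x - {a}) ` parity_class A b = Pow (A - {a})"
proof (intro subset_antisym subsetI)
  fix y assume y: "y \<in> Pow (A - {a})"
  then have "y \<in> parity_class A b \<or> toggle a y \<in> parity_class A b"
    using toggle_in_parity_class[OF assms, of y "\<not> b"] by (auto simp: parity_class_def)
  moreover have "y - {a} = y" "toggle a y - {a} = y"
    using y by auto
  ultimately show "y \<in> (\<lambda>x. x - {a}) ` parity_class A b"
    by (metis imageI)
qed (auto simp: parity_class_def)

lemma card_parity_class:
  assumes "finite A" "a \<in> A"
  shows "card (parity_class A b) = 2 ^ card (A - {a})"
  using card_image[OF inj_on_project_parity_class[OF assms]] assms
  by (simp add: project_parity_class card_Pow)

lemma project_notin_closed_nbhd: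
  assumes A: "finite A" "a \<in> A" and X: "X \<subseteq> parity_class A b" and y: "y \<in> parity_class A (\<not> b)"
    and no_edge: "\<And>i. i \<in> A \<Longrightarrow> toggle i y \<notin> X"
  shows "y - {a} \<notin> closed_nbhd (A - {a}) ((\<lambda>x. x - {a}) ` X)"
proof
  assume "y - {a} \<in> closed_nbhd (A - {a}) ((\<lambda>x. x - {a}) ` X)"
  then consider x where "x \<in> X" "x - {a} = y - {a}"
    | x i where "x \<in> X" "i \<in> A" "i \<noteq> a" "x - {a} = toggle i (y - {a})"
    by (auto simp: closed_nbhd_def image_iff)
  then show False
  proof cases
    case (1 x)
    then have "x = y \<or> x = toggle a y"
      by (metis diff_singleton_eqD)
    then show False
      using no_edge[OF A(2)] 1(1) X y by (auto dest: parity_class_disjoint)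
  next
    case (2 x i)
    then have "x - {a} = toggle i y - {a}"
      by (simp add: toggle_diff_singleton)
    then have "x = toggle a (toggle i y)"
      using no_edge[OF 2(2)] 2(1) by (metis diff_singleton_eqD)
    moreover have "toggle i y \<in> parity_class A b"
      using toggle_in_parity_class[OF A(1) 2(2) y] by simp
    then have "toggle a (toggle i y) \<in> parity_class A (\<not> b)"
      by (rule toggle_in_parity_class[OF A])
    ultimately show False
      using 2(1) X by (auto dest: parity_class_disjoint)
  qed
qed

lemma card_closed_nbhd_project_add_le:
  assumes A: "finite A" "a \<in> A" and X: "X \<subseteq> parity_class A b" and Y: "Y \<subseteq> parity_class A (\<not> b)"
    and no_edge: "\<And>x i. x \<in> X \<Longrightarrow> i \<in> A \<Longrightarrow> toggle i x \<notin> Y"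
  shows "card (closed_nbhd (A - {a}) ((\<lambda>x. x - {a}) ` X)) + card Y \<le> 2 ^ card (A - {a})"
proof -
  let ?p = "\<lambda>x. x - {a}"
  have sub: "?p ` X \<subseteq> Pow (A - {a})" "?p ` Y \<subseteq> Pow (A - {a})"
    using X Y by (auto simp: parity_class_def)
  have "?p y \<notin> closed_nbhd (A - {a}) (?p ` X)" if "y \<in> Y" for y
  proof (rule project_notin_closed_nbhd[OF A X])
    show "toggle i y \<notin> X" if "i \<in> A" for i
      using no_edge[of "toggle i y" i] that \<open>y \<in> Y\<close> by auto
  qed (use that Y in blast)
  then have "closed_nbhd (A - {a}) (?p ` X) \<inter> ?p ` Y = {}"
    by auto
  moreover have "card (?p ` Y) = card Y"
    by (rule card_image[OF inj_on_subset[OF inj_on_project_parity_class[OF A] Y]])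
  ultimately have "card (closed_nbhd (A - {a}) (?p ` X)) + card Y
      = card (closed_nbhd (A - {a}) (?p ` X) \<union> ?p ` Y)"
    using finite_closed_nbhd[OF _ sub(1)] finite_subset[OF sub(2)] A
    by (subst card_Un_disjoint) auto
  also have "\<dots> \<le> 2 ^ card (A - {a})"
    using closed_nbhd_subset_Pow[OF sub(1)] sub(2) A by (intro card_le_of_subset_Pow) auto
  finally show ?thesis .
qed

lemma card_add_le_if_no_edge:
  assumes A: "finite A" "a \<in> A" and X: "X \<subseteq> parity_class A b" and Y: "Y \<subseteq> parity_class A (\<not> b)"
    and no_edge: "\<And>x i. x \<in> X \<Longrightarrow> i \<in> A \<Longrightarrow> toggle i x \<notin> Y"
    and isoperimetric: "\<And>S. S \<subseteq> Pow (A - {a}) \<Longrightarrow> card S = card X \<Longrightarrow>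
      card X + c \<le> card (closed_nbhd (A - {a}) S)"
  shows "card X + c + card Y \<le> 2 ^ card (A - {a})"
proof -
  let ?S = "(\<lambda>x. x - {a}) ` X"
  have "?S \<subseteq> Pow (A - {a})"
    using X by (auto simp: parity_class_def)
  moreover have "card ?S = card X"
    by (rule card_image[OF inj_on_subset[OF inj_on_project_parity_class[OF A] X]])
  ultimately have "card X + c \<le> card (closed_nbhd (A - {a}) ?S)"
    by (rule isoperimetric)
  then show ?thesis
    using card_closed_nbhd_project_add_le[OF A X Y no_edge] by linarith
qed

section \<open>Numberings with large gaps\<close>

locale separated_numbering =
  fixes A :: "'a::wellorder set" and \<eta> :: "'a set \<Rightarrow> nat" and k :: nat
  assumes finite_A: "finite A"
    and bij: "bij_betw \<eta> (Pow A) {1..2 ^ card A}"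
    and sep: "x \<in> Pow A \<Longrightarrow> i \<in> A \<Longrightarrow> \<eta> x + k \<le> \<eta> (toggle i x) \<or> \<eta> (toggle i x) + k \<le> \<eta> x"
    and k_pos: "0 < k"

definition parity_rank_numbering :: "'a::wellorder set \<Rightarrow> 'a \<Rightarrow> 'a set \<Rightarrow> nat" where
  "parity_rank_numbering A a x =
     Suc (rank (A - {a}) (x - {a})) + (if even (card x) then 0 else 2 ^ card (A - {a}))"

lemma bij_betw_parity_rank_numbering:
  assumes "finite A" "a \<in> A"
  shows "bij_betw (parity_rank_numbering A a) (Pow A) {1..2 ^ card A}"
proof -
  let ?N = "2 ^ card (A - {a}) :: nat" and ?\<eta> = "parity_rank_numbering A a"
  have card_A: "card A = Suc (card (A - {a}))"
    using assms by (metis card_Suc_Diff1)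
  have rank_less: "rank (A - {a}) (x - {a}) < ?N" if "x \<in> Pow A" for x
    using that assms by (intro rank_less_card_Pow) auto
  have "inj_on ?\<eta> (Pow A)"
  proof (rule inj_onI)
    fix x y assume xy: "x \<in> Pow A" "y \<in> Pow A" "?\<eta> x = ?\<eta> y"
    then have parity: "even (card x) \<longleftrightarrow> even (card y)"
      using rank_less[OF xy(1)] rank_less[OF xy(2)]
      by (auto simp: parity_rank_numbering_def split: if_splits)
    then have "rank (A - {a}) (x - {a}) = rank (A - {a}) (y - {a})"
      using xy(3) by (simp add: parity_rank_numbering_def)
    then have "x - {a} = y - {a}"
      using inj_onD[OF inj_on_rank[of "A - {a}"]] xy assms(1) by blast
    then show "x = y"
      using inj_on_project_parity_class[OF assms, of "even (card x)"] xy parity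
      by (auto simp: parity_class_def dest: inj_onD)
  qed
  moreover have "?\<eta> ` Pow A = {1..2 ^ card A}"
  proof (rule card_subset_eq)
    show "?\<eta> ` Pow A \<subseteq> {1..2 ^ card A}"
    proof (rule image_subsetI)
      fix x assume "x \<in> Pow A"
      from rank_less[OF this] show "?\<eta> x \<in> {1..2 ^ card A}"
        by (simp add: parity_rank_numbering_def card_A)
    qed
    show "card (?\<eta> ` Pow A) = card {1..2 ^ card A :: nat}"
      using card_image[OF \<open>inj_on ?\<eta> (Pow A)\<close>] assms(1) by (simp add: card_Pow)
  qed simp
  ultimately show ?thesis
    by (simp add: bij_betw_def)
qed

lemma separated_parity_rank_numbering:
  assumes A: "finite A" "a \<in> A"
  shows "separated_numbering A (parity_rank_numbering A a)
    (2 ^ card (A - {a}) - central_sum (card (A - {a})))"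
proof
  let ?B = "A - {a}" and ?N = "2 ^ card (A - {a}) :: nat" and ?c = "central_sum (card (A - {a}))"
  fix x i assume x: "x \<in> Pow A" and i: "i \<in> A"
  have "finite x"
    using A(1) x finite_subset by auto
  have step: "rank ?B (toggle i z - {a}) \<le> rank ?B (z - {a}) + ?c" if "z \<in> Pow A" for z
  proof (cases "i = a")
    case False
    then show ?thesis
      using rank_toggle_le[of ?B "z - {a}" i] that i A(1) by (auto simp: toggle_diff_singleton)
  qed simp
  have "rank ?B (toggle i x - {a}) \<le> rank ?B (x - {a}) + ?c"
    "rank ?B (x - {a}) \<le> rank ?B (toggle i x - {a}) + ?c"
    using step[OF x] step[OF toggle_in_Pow[OF x i]] by simp_all
  then show "parity_rank_numbering A a x + (?N - ?c) \<le> parity_rank_numbering A a (toggle i x) \<or>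
      parity_rank_numbering A a (toggle i x) + (?N - ?c) \<le> parity_rank_numbering A a x"
    using central_sum_less[of "card ?B"]
    by (auto simp: parity_rank_numbering_def even_card_toggle[OF \<open>finite x\<close>])
qed (use A bij_betw_parity_rank_numbering central_sum_less in auto)

context separated_numbering
begin

lemma label_bounds: "x \<in> Pow A \<Longrightarrow> 1 \<le> \<eta> x \<and> \<eta> x \<le> 2 ^ card A"
  using bij_betwE[OF bij] by auto

lemma inj_on_label: "inj_on \<eta> (Pow A)"
  by (rule bij_betw_imp_inj_on[OF bij])

lemma card_label_preimage:
  assumes "L \<subseteq> {1..2 ^ card A}"
  shows "card {x \<in> Pow A. \<eta> x \<in> L} = card L"
proof -
  have "bij_betw \<eta> {x \<in> Pow A. \<eta> x \<in> L} L"
    by (rule bij_betw_subset[OF bij]) (use bij assms in \<open>auto simp: bij_betw_def\<close>)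
  then show ?thesis
    by (rule bij_betw_same_card)
qed

lemma k_less: "A \<noteq> {} \<Longrightarrow> k < 2 ^ card A"
  using sep[of "{}"] label_bounds[of "{}"] label_bounds[of "toggle _ {}"]
  by (fastforce simp: toggle_def)

definition window :: "nat \<Rightarrow> 'a set set" where
  "window \<tau> = {u \<in> Pow A. \<eta> u \<in> {\<tau>..<\<tau> + k}}"

lemma card_window:
  assumes "1 \<le> \<tau>" "\<tau> + k \<le> 2 ^ card A + 1"
  shows "card (window \<tau>) = k"
  unfolding window_def using assms by (subst card_label_preimage) auto

lemma toggle_notin_window: "u \<in> window \<tau> \<Longrightarrow> i \<in> A \<Longrightarrow> toggle i u \<notin> window \<tau>"
  using sep[of u i] by (auto simp: window_def)

lemma inj_on_project_window:
  assumes "a \<in> A"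
  shows "inj_on (\<lambda>u. u - {a}) (window \<tau>)"
proof (rule inj_onI)
  fix u v assume uv: "u \<in> window \<tau>" "v \<in> window \<tau>" "u - {a} = v - {a}"
  then have "u \<noteq> toggle a v"
    using toggle_notin_window[OF _ assms] by blast
  then show "u = v"
    using diff_singleton_eqD[OF uv(3)] by blast
qed

definition orientation :: "'a set \<Rightarrow> 'a \<Rightarrow> int" where
  "orientation x i = (if \<eta> x < \<eta> (toggle i x) then 1 else - 1)"

lemma orientation_cases:
  assumes "x \<in> Pow A" "i \<in> A"
  obtains (up) "orientation x i = 1" "\<eta> x + k \<le> \<eta> (toggle i x)"
    | (down) "orientation x i = - 1" "\<eta> (toggle i x) + k \<le> \<eta> x"
  using sep[OF assms] k_pos by (fastforce simp: orientation_def)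

lemma orientation_toggle:
  assumes "x \<in> Pow A" "i \<in> A"
  shows "orientation (toggle i x) i = - orientation x i"
  using sep[OF assms] k_pos by (auto simp: orientation_def)

end

section \<open>Sweeping a height function\<close>

definition is_potential :: "'a set \<Rightarrow> ('a set \<Rightarrow> 'a \<Rightarrow> 'b::ab_group_add) \<Rightarrow> ('a set \<Rightarrow> 'b) \<Rightarrow> bool" where
  "is_potential A \<theta> h \<longleftrightarrow> (\<forall>x\<in>Pow A. \<forall>i\<in>A. h (toggle i x) = h x + \<theta> x i)"

lemma is_potentialD: "is_potential A \<theta> h \<Longrightarrow> x \<in> Pow A \<Longrightarrow> i \<in> A \<Longrightarrow> h (toggle i x) = h x + \<theta> x i"
  by (simp add: is_potential_def)

lemma is_potential_insert:
  assumes h: "is_potential A \<theta> h"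
    and antisym: "\<And>x. x \<in> Pow (insert a A) \<Longrightarrow> \<theta> (toggle a x) a = - \<theta> x a"
    and square: "\<And>x i. x \<in> Pow A \<Longrightarrow> i \<in> A \<Longrightarrow>
      \<theta> x a + \<theta> (toggle a x) i = \<theta> x i + \<theta> (toggle i x) a"
  shows "is_potential (insert a A) \<theta> (\<lambda>x. if a \<in> x then h (x - {a}) + \<theta> (x - {a}) a else h x)"
    (is "is_potential _ _ ?g")
  unfolding is_potential_def
proof (intro ballI)
  fix x i assume x: "x \<in> Pow (insert a A)" and i: "i \<in> insert a A"
  define y where "y = x - {a}"
  have y: "y \<in> Pow A" "a \<notin> y"
    using x by (auto simp: y_def)
  consider "i = a" | "i \<noteq> a" "a \<notin> x" | "i \<noteq> a" "a \<in> x"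
    by blast
  then show "?g (toggle i x) = ?g x + \<theta> x i"
  proof cases
    case 1
    then show ?thesis
      using antisym[OF x] by (cases "a \<in> x") (auto simp: toggle_def insert_absorb)
  next
    case 2
    then show ?thesis
      using is_potentialD[OF h, of x i] x i by (auto simp: mem_toggle_iff)
  next
    case 3
    then have "toggle a y = x" "toggle i x - {a} = toggle i y"
      by (auto simp: y_def mem_toggle_iff)
    then show ?thesis
      using square[OF y(1), of i] is_potentialD[OF h y(1), of i] i 3
      by (simp add: mem_toggle_iff algebra_simps flip: y_def)
  qed
qed

lemma is_potential_ex:
  fixes \<theta> :: "'a set \<Rightarrow> 'a \<Rightarrow> 'b::ab_group_add"
  assumes "finite A"
    and "\<And>x i. x \<in> Pow A \<Longrightarrow> i \<in> A \<Longrightarrow> \<theta> (toggle i x) i = - \<theta> x i"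
    and "\<And>x i j. x \<in> Pow A \<Longrightarrow> i \<in> A \<Longrightarrow> j \<in> A \<Longrightarrow>
      \<theta> x i + \<theta> (toggle i x) j = \<theta> x j + \<theta> (toggle j x) i"
  shows "\<exists>h. h {} = 0 \<and> is_potential A \<theta> h"
  using assms
proof (induction A rule: finite_induct)
  case empty
  then show ?case
    by (auto simp: is_potential_def)
next
  case (insert a A)
  note antisym = insert.prems(1) and square = insert.prems(2)
  have "\<exists>h. h {} = 0 \<and> is_potential A \<theta> h"
    by (rule insert.IH; (rule antisym | rule square); auto)
  then obtain h where h: "h {} = 0" "is_potential A \<theta> h"
    by blast
  have "is_potential (insert a A) \<theta> (\<lambda>x. if a \<in> x then h (x - {a}) + \<theta> (x - {a}) a else h x)"
    by (rule is_potential_insert[OF h(2)]; (rule antisym | rule square); auto)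
  with h(1) show ?case
    by (intro exI[of _ "\<lambda>x. if a \<in> x then h (x - {a}) + \<theta> (x - {a}) a else h x"]) simp
qed

locale numbering_with_height = separated_numbering +
  fixes a :: 'a and h :: "'a set \<Rightarrow> int"
  assumes a_in: "a \<in> A"
    and height_empty: "h {} = 0"
    and height_potential: "is_potential A orientation h"
begin

lemma height_toggle_cases:
  assumes "x \<in> Pow A" "i \<in> A"
  obtains (up) "h (toggle i x) = h x + 1" "\<eta> x + k \<le> \<eta> (toggle i x)"
    | (down) "h (toggle i x) = h x - 1" "\<eta> (toggle i x) + k \<le> \<eta> x"
  using assms is_potentialD[OF height_potential assms] by (cases rule: orientation_cases) auto

lemma even_height_iff_and_height_bound:
  assumes "x \<in> Pow A"
  shows "(even (h x) \<longleftrightarrow> even (card x)) \<and> \<bar>h x\<bar> \<le> int (card x)"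
proof -
  have "finite x"
    using assms finite_A finite_subset by auto
  then show ?thesis
    using assms
  proof (induction x rule: finite_induct)
    case (insert i x)
    then have "x \<in> Pow A" "i \<in> A" "toggle i x = insert i x"
      by (auto simp: toggle_def)
    then have "h (insert i x) = h x + 1 \<or> h (insert i x) = h x - 1"
      by (metis height_toggle_cases)
    then show ?case
      using insert by auto
  qed (simp add: height_empty)
qed

lemma even_height_iff: "x \<in> Pow A \<Longrightarrow> even (h x) \<longleftrightarrow> even (card x)"
  using even_height_iff_and_height_bound by blast

lemma height_bound: "x \<in> Pow A \<Longrightarrow> \<bar>h x\<bar> \<le> int (card A)"
  using even_height_iff_and_height_bound[of x] card_mono[OF finite_A, of x] by fastforce

text \<open>The parity restriction makes the projection along \<open>a\<close> injective on both sweep sets.\<close>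

definition lower_sweep :: "int \<Rightarrow> nat \<Rightarrow> 'a set set" where
  "lower_sweep j \<tau> = {u \<in> parity_class A (even j). h u < j \<or> (h u = j \<and> \<tau> \<le> \<eta> u)}"

definition upper_sweep :: "int \<Rightarrow> nat \<Rightarrow> 'a set set" where
  "upper_sweep j \<tau> = {u \<in> parity_class A (odd j). j + 1 < h u \<or> (h u = j + 1 \<and> \<eta> u < \<tau> + k)}"

lemma sweeps_subset_Pow: "lower_sweep j \<tau> \<subseteq> Pow A" "upper_sweep j \<tau> \<subseteq> Pow A"
  by (auto simp: lower_sweep_def upper_sweep_def parity_class_def)

lemma finite_sweeps: "finite (lower_sweep j \<tau>)" "finite (upper_sweep j \<tau>)"
  using sweeps_subset_Pow finite_A by (meson finite_Pow_iff finite_subset)+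

lemma no_edge_between_sweeps:
  assumes "u \<in> lower_sweep j \<tau>" "i \<in> A"
  shows "toggle i u \<notin> upper_sweep j \<tau>"
proof -
  have "u \<in> Pow A"
    using assms(1) sweeps_subset_Pow by blast
  then show ?thesis
    using assms(2)
    by (cases rule: height_toggle_cases)
      (use assms(1) in \<open>auto simp: lower_sweep_def upper_sweep_def\<close>)
qed

lemma window_meets_sweeps:
  assumes u: "u \<in> window \<tau>"
  shows "u \<in> lower_sweep j \<tau> \<union> upper_sweep j \<tau> \<or> toggle a u \<in> lower_sweep j \<tau> \<union> upper_sweep j \<tau>"
proof -
  have uA: "u \<in> Pow A" and label: "\<tau> \<le> \<eta> u" "\<eta> u < \<tau> + k"
    using u by (auto simp: window_def)
  have parity: "u \<in> parity_class A (even j) \<longleftrightarrow> even (h u - j)"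
    "u \<in> parity_class A (odd j) \<longleftrightarrow> odd (h u - j)"
    using even_height_iff[OF uA] uA by (auto simp: parity_class_def)
  have toggled: "toggle a u \<in> parity_class A (\<not> b)" if "u \<in> parity_class A b" for b
    by (rule toggle_in_parity_class[OF finite_A a_in that])
  have "h u \<le> j \<or> j + 2 \<le> h u" if "even (h u - j)"
    using that by presburger
  moreover have "h u \<le> j - 1 \<or> j + 1 \<le> h u" if "odd (h u - j)"
    using that by presburger
  ultimately consider "u \<in> parity_class A (even j)" "h u \<le> j"
    | "u \<in> parity_class A (even j)" "j + 2 \<le> h u"
    | "u \<in> parity_class A (odd j)" "h u \<le> j - 1"
    | "u \<in> parity_class A (odd j)" "j + 1 \<le> h u"
    using parity by blast
  then show ?thesis
  proof cases
    case 2
    from uA a_in have "toggle a u \<in> upper_sweep j \<tau>"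
      by (cases rule: height_toggle_cases)
        (use 2 label toggled[of "even j"] in \<open>auto simp: upper_sweep_def\<close>)
    then show ?thesis by blast
  next
    case 3
    from uA a_in have "toggle a u \<in> lower_sweep j \<tau>"
      by (cases rule: height_toggle_cases)
        (use 3 label toggled[of "odd j"] in \<open>auto simp: lower_sweep_def\<close>)
    then show ?thesis by blast
  qed (use label in \<open>auto simp: lower_sweep_def upper_sweep_def\<close>)
qed

lemma card_sweeps_ge:
  assumes "1 \<le> \<tau>" "\<tau> + k \<le> 2 ^ card A + 1"
  shows "k \<le> card (lower_sweep j \<tau>) + card (upper_sweep j \<tau>)"
proof -
  let ?p = "\<lambda>u. u - {a}" and ?S = "lower_sweep j \<tau> \<union> upper_sweep j \<tau>"
  have fin: "finite ?S"
    by (simp add: finite_sweeps)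
  have "?p ` window \<tau> \<subseteq> ?p ` ?S"
  proof (rule image_subsetI)
    fix u assume "u \<in> window \<tau>"
    then have "u \<in> ?S \<or> toggle a u \<in> ?S"
      by (rule window_meets_sweeps)
    then show "?p u \<in> ?p ` ?S"
      using imageI[of u ?S ?p] imageI[of "toggle a u" ?S ?p] by auto
  qed
  then have "card (?p ` window \<tau>) \<le> card (?p ` ?S)"
    using fin by (intro card_mono) auto
  also have "\<dots> \<le> card ?S"
    using fin by (rule card_image_le)
  also have "\<dots> \<le> card (lower_sweep j \<tau>) + card (upper_sweep j \<tau>)"
    by (rule card_Un_le)
  finally show ?thesis
    using card_image[OF inj_on_project_window[OF a_in]] card_window[OF assms] by simp
qed

lemma card_lower_sweep_Suc: "card (lower_sweep j \<tau>) \<le> Suc (card (lower_sweep j (Suc \<tau>)))"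
proof -
  have "lower_sweep j \<tau> \<subseteq> insert (inv_into (Pow A) \<eta> \<tau>) (lower_sweep j (Suc \<tau>))"
  proof
    fix u assume u: "u \<in> lower_sweep j \<tau>"
    then have "inv_into (Pow A) \<eta> (\<eta> u) = u"
      using sweeps_subset_Pow(1)[of j \<tau>] by (intro inv_into_f_f[OF inj_on_label]) auto
    then show "u \<in> insert (inv_into (Pow A) \<eta> \<tau>) (lower_sweep j (Suc \<tau>))"
      using u by (cases "\<eta> u = \<tau>") (auto simp: lower_sweep_def)
  qed
  then have "card (lower_sweep j \<tau>) \<le> card (insert (inv_into (Pow A) \<eta> \<tau>) (lower_sweep j (Suc \<tau>)))"
    by (intro card_mono) (simp_all add: finite_sweeps)
  then show ?thesis
    by (simp add: card_insert_if finite_sweeps split: if_splits)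
qed

lemma card_lower_sweep_next_level:
  assumes "2 ^ card A < \<tau> + k"
  shows "card (lower_sweep j \<tau>) \<le> card (lower_sweep (j - 1) 1)"
proof -
  have "toggle a u \<in> lower_sweep (j - 1) 1" if u: "u \<in> lower_sweep j \<tau>" for u
  proof -
    have parity: "toggle a u \<in> parity_class A (even (j - 1))"
      using toggle_in_parity_class[OF finite_A a_in, of u "even j"] u by (simp add: lower_sweep_def)
    have uA: "u \<in> Pow A"
      using u sweeps_subset_Pow by blast
    have labels: "1 \<le> \<eta> (toggle a u)" "\<eta> (toggle a u) < \<tau> + k"
      using label_bounds[OF toggle_in_Pow[OF uA a_in]] assms by auto
    have "h u \<noteq> j - 1"
      using even_height_iff[OF uA] u by (auto simp: lower_sweep_def parity_class_def)
    from uA a_in show ?thesis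
      by (cases rule: height_toggle_cases)
        (use u labels parity \<open>h u \<noteq> j - 1\<close> in \<open>auto simp: lower_sweep_def\<close>)
  qed
  then show ?thesis
    by (intro card_inj_on_le[of "toggle a"]) (auto simp: inj_on_def finite_sweeps)
qed

lemma lower_sweep_top:
  assumes "int (card A) < j"
  shows "lower_sweep j \<tau> = parity_class A (even j)"
proof -
  have "h u < j" if "u \<in> parity_class A (even j)" for u
    using that height_bound[of u] assms by (simp add: parity_class_def)
  then show ?thesis
    by (auto simp: lower_sweep_def)
qed

lemma lower_sweep_bottom:
  assumes "j < - int (card A)"
  shows "lower_sweep j \<tau> = {}"
proof -
  have "j < h u" if "u \<in> parity_class A (even j)" for u
    using that height_bound[of u] assms by (simp add: parity_class_def)
  then show ?thesis
    by (fastforce simp: lower_sweep_def)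
qed

lemma lower_sweep_card_attained:
  assumes s: "s \<le> 2 ^ card (A - {a})"
  shows "\<exists>j \<tau>. 1 \<le> \<tau> \<and> \<tau> + k \<le> 2 ^ card A + 1 \<and> card (lower_sweep j \<tau>) = s"
proof (rule ccontr)
  assume avoided: "\<not> ?thesis"
  define T where "T = 2 ^ card A + 1 - k"
  have "k < 2 ^ card A"
    using k_less a_in by blast
  then have T: "1 \<le> T" "T + k = 2 ^ card A + 1"
    by (auto simp: T_def)
  have neq: "card (lower_sweep j \<tau>) \<noteq> s" if "1 \<le> \<tau>" "\<tau> \<le> T" for j \<tau>
    using avoided that T(2) by auto
  have level: "s < card (lower_sweep j \<tau>)"
    if start: "s < card (lower_sweep j 1)" and "1 \<le> \<tau>" "\<tau> \<le> T" for j \<tau>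
    using that(2,3)
  proof (induction \<tau> rule: dec_induct)
    case (step \<tau>)
    then show ?case
      using card_lower_sweep_Suc[of j \<tau>] neq[of "Suc \<tau>" j] by simp
  qed (use start in simp)
  have next_level: "s < card (lower_sweep (j - 1) 1)" if "s < card (lower_sweep j 1)" for j
    using level[OF that T(1) order_refl] card_lower_sweep_next_level[of T j] T(2) by simp
  have "s < card (lower_sweep j 1)" if "j \<le> int (card A) + 1" for j
    using that
  proof (induction j rule: int_le_induct)
    case base
    have "card (lower_sweep (int (card A) + 1) 1) = 2 ^ card (A - {a})"
      by (simp add: lower_sweep_top card_parity_class[OF finite_A a_in])
    then show ?case
      using s neq[OF order_refl T(1)] by (metis order_le_imp_less_or_eq)
  qed (rule next_level)
  from this[of "- int (card A) - 1"] show False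
    by (simp add: lower_sweep_bottom)
qed

lemma gap_le_if_height: "k + central_sum (card (A - {a})) \<le> 2 ^ card (A - {a})"
proof -
  let ?B = "A - {a}"
  obtain s where s: "s \<le> 2 ^ card ?B"
    "\<forall>S\<subseteq>Pow ?B. card S = s \<longrightarrow> s + central_sum (card ?B) \<le> card (closed_nbhd ?B S)"
    using critical_size_ex finite_A by blast
  obtain j \<tau> where \<tau>: "1 \<le> \<tau>" "\<tau> + k \<le> 2 ^ card A + 1" and card: "card (lower_sweep j \<tau>) = s"
    using lower_sweep_card_attained[OF s(1)] by blast
  have "card (lower_sweep j \<tau>) + central_sum (card ?B) + card (upper_sweep j \<tau>) \<le> 2 ^ card ?B"
  proof (rule card_add_le_if_no_edge[OF finite_A a_in])
    show "lower_sweep j \<tau> \<subseteq> parity_class A (even j)" "upper_sweep j \<tau> \<subseteq> parity_class A (odd j)"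
      by (auto simp: lower_sweep_def upper_sweep_def)
  qed (use s(2) card no_edge_between_sweeps in auto)
  then show ?thesis
    using card_sweeps_ge[OF \<tau>, of j] by linarith
qed

end

section \<open>Unbalanced faces\<close>

lemma sum_card_fibres_le:
  assumes "finite S" "finite Z"
  shows "(\<Sum>z\<in>Z. card {w \<in> S. f w = z}) \<le> card S"
proof -
  have "(\<Sum>z\<in>Z. card {w \<in> S. f w = z}) = card (\<Union>z\<in>Z. {w \<in> S. f w = z})"
    using assms by (subst card_UN_disjoint) auto
  also have "\<dots> \<le> card S"
    using assms(1) by (intro card_mono) auto
  finally show ?thesis .
qed

definition face :: "'a set \<Rightarrow> 'a \<Rightarrow> 'a \<Rightarrow> 'a set set" where
  "face x i j = {x, toggle i x, toggle j x, toggle i (toggle j x)}"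

lemma card_face: "i \<noteq> j \<Longrightarrow> card (face x i j) = 4"
proof -
  assume "i \<noteq> j"
  then have "x \<noteq> toggle i (toggle j x)"
    by (metis mem_toggle_iff)
  with \<open>i \<noteq> j\<close> show ?thesis
    by (simp add: face_def toggle_commute[of i j])
qed

lemma unbalanced_four_cycle_chain:
  fixes \<alpha> \<beta> \<gamma> \<delta> k :: nat
  assumes "\<alpha> + k \<le> \<beta> \<or> \<beta> + k \<le> \<alpha>" "\<alpha> + k \<le> \<gamma> \<or> \<gamma> + k \<le> \<alpha>"
    and "\<beta> + k \<le> \<delta> \<or> \<delta> + k \<le> \<beta>" "\<gamma> + k \<le> \<delta> \<or> \<delta> + k \<le> \<gamma>"
    and "0 < k"
    and "(if \<alpha> < \<beta> then 1 else - 1) + (if \<beta> < \<delta> then 1 else - 1)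
      \<noteq> (if \<alpha> < \<gamma> then 1 else - 1) + (if \<gamma> < \<delta> then 1 else - 1 :: int)"
  shows "\<exists>p q r s. {\<alpha>, \<beta>, \<gamma>, \<delta>} = {p, q, r, s} \<and> p + k \<le> q \<and> q + k \<le> r \<and> r + k \<le> s"
proof -
  let ?chain = "\<lambda>p q r s. p + k \<le> q \<and> q + k \<le> r \<and> r + k \<le> s"
  have "?chain \<alpha> \<beta> \<delta> \<gamma> \<or> ?chain \<alpha> \<gamma> \<delta> \<beta> \<or> ?chain \<gamma> \<alpha> \<beta> \<delta> \<or> ?chain \<beta> \<alpha> \<gamma> \<delta> \<or>
      ?chain \<delta> \<beta> \<alpha> \<gamma> \<or> ?chain \<delta> \<gamma> \<alpha> \<beta> \<or> ?chain \<gamma> \<delta> \<beta> \<alpha> \<or> ?chain \<beta> \<delta> \<gamma> \<alpha>"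
    using assms by (elim disjE) simp_all
  moreover have "{\<alpha>, \<beta>, \<gamma>, \<delta>} = {\<alpha>, \<beta>, \<delta>, \<gamma>}" "{\<alpha>, \<beta>, \<gamma>, \<delta>} = {\<alpha>, \<gamma>, \<delta>, \<beta>}"
    "{\<alpha>, \<beta>, \<gamma>, \<delta>} = {\<gamma>, \<alpha>, \<beta>, \<delta>}" "{\<alpha>, \<beta>, \<gamma>, \<delta>} = {\<beta>, \<alpha>, \<gamma>, \<delta>}"
    "{\<alpha>, \<beta>, \<gamma>, \<delta>} = {\<delta>, \<beta>, \<alpha>, \<gamma>}" "{\<alpha>, \<beta>, \<gamma>, \<delta>} = {\<delta>, \<gamma>, \<alpha>, \<beta>}"
    "{\<alpha>, \<beta>, \<gamma>, \<delta>} = {\<gamma>, \<delta>, \<beta>, \<alpha>}" "{\<alpha>, \<beta>, \<gamma>, \<delta>} = {\<beta>, \<delta>, \<gamma>, \<alpha>}"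
    by auto
  ultimately show ?thesis
    by metis
qed

lemma chain_subset_intervals:
  fixes p q r s k M :: nat
  assumes "0 < p" "p + k \<le> q" "q + k \<le> r" "r + k \<le> s" "s \<le> M"
  shows "{p, q, r, s} \<subseteq> (\<Union>t<4. {t * k<..M - (3 - t) * k})"
proof -
  have "p \<in> {0 * k<..M - (3 - 0) * k}" "q \<in> {1 * k<..M - (3 - 1) * k}"
    "r \<in> {2 * k<..M - (3 - 2) * k}" "s \<in> {3 * k<..M - (3 - 3) * k}"
    using assms by simp_all
  moreover have "0 < (4::nat)" "1 < (4::nat)" "2 < (4::nat)" "3 < (4::nat)"
    by simp_all
  ultimately show ?thesis
    by blast
qed

context separated_numbering
begin

definition balanced :: "'a set \<Rightarrow> 'a \<Rightarrow> 'a \<Rightarrow> bool" where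
  "balanced x i j \<longleftrightarrow>
     orientation x i + orientation (toggle i x) j = orientation x j + orientation (toggle j x) i"

text \<open>The interval with index \<open>t\<close> consists of the labels that can occupy position \<open>t\<close> of a chain of
  four labels increasing in steps of at least \<open>k\<close>.\<close>

definition extremal :: "'a set set" where
  "extremal = {x \<in> Pow A. \<eta> x \<in> (\<Union>t<4. {t * k<..2 ^ card A - (3 - t) * k})}"

lemma finite_extremal: "finite extremal"
  using finite_A by (simp add: extremal_def)

lemma card_extremal_le: "card extremal \<le> 4 * (2 ^ card A - 3 * k)"
proof -
  have "card extremal = card (\<Union>t<4. {t * k<..2 ^ card A - (3 - t) * k})"
    unfolding extremal_def by (rule card_label_preimage) auto
  also have "\<dots> \<le> (\<Sum>t<4. card {t * k<..2 ^ card A - (3 - t) * k})"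
    by (rule card_UN_le) simp
  also have "\<dots> = (\<Sum>t<4::nat. 2 ^ card A - 3 * k)"
    by (intro sum.cong refl) (simp flip: add_mult_distrib)
  finally show ?thesis
    by simp
qed

lemma face_extremal_if_unbalanced:
  assumes x: "x \<in> Pow A" and ij: "i \<in> A" "j \<in> A" and unbalanced: "\<not> balanced x i j"
  shows "face x i j \<subseteq> extremal"
proof -
  have face: "toggle i x \<in> Pow A" "toggle j x \<in> Pow A" "toggle i (toggle j x) \<in> Pow A"
    using x ij by (simp_all add: toggle_in_Pow del: Pow_iff)
  let ?labels = "{\<eta> x, \<eta> (toggle i x), \<eta> (toggle j x), \<eta> (toggle i (toggle j x))}"
  have "\<exists>p q r s. ?labels = {p, q, r, s} \<and> p + k \<le> q \<and> q + k \<le> r \<and> r + k \<le> s"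
    using sep[OF x ij(1)] sep[OF x ij(2)] sep[OF face(1) ij(2)] sep[OF face(2) ij(1)]
      k_pos unbalanced
    by (intro unbalanced_four_cycle_chain)
      (auto simp: balanced_def orientation_def toggle_commute[of j i])
  then obtain p q r s where chain: "?labels = {p, q, r, s}" "p + k \<le> q" "q + k \<le> r" "r + k \<le> s"
    by blast
  have "?labels \<subseteq> {1..2 ^ card A}"
    using label_bounds x face by simp
  then have "?labels \<subseteq> (\<Union>t<4. {t * k<..2 ^ card A - (3 - t) * k})"
    unfolding chain(1) using chain(2-4) by (intro chain_subset_intervals) auto
  then show ?thesis
    using x face by (simp add: face_def extremal_def)
qed

text \<open>The circulations around the six faces of the 3-cube spanned by \<open>i\<close>, \<open>j\<close>, \<open>l\<close> cancel.\<close>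

lemma unbalanced_opposite_or_adjacent:
  assumes "\<not> balanced x i j"
  shows "\<not> balanced (toggle l x) i j \<or> \<not> balanced x i l \<or> \<not> balanced (toggle j x) i l
    \<or> \<not> balanced x j l \<or> \<not> balanced (toggle i x) j l"
  using assms unfolding balanced_def
  by (simp add: toggle_commute[of j i] toggle_commute[of l i] toggle_commute[of l j])

lemma two_extremal_neighbours:
  assumes x: "x \<in> Pow A" and ij: "i \<in> A" "j \<in> A" "i \<noteq> j" and unbalanced: "\<not> balanced x i j"
    and l: "l \<in> A"
  shows "\<exists>u\<in>face x i j. \<exists>v\<in>face x i j. u \<noteq> v \<and> toggle l u \<in> extremal \<and> toggle l v \<in> extremal"
proof -
  have vertices: "toggle i x \<in> Pow A" "toggle j x \<in> Pow A" "toggle l x \<in> Pow A"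
    using x ij l by (simp_all add: toggle_in_Pow del: Pow_iff)
  consider "\<not> balanced (toggle l x) i j" | "\<not> balanced x i l" | "\<not> balanced (toggle j x) i l"
    | "\<not> balanced x j l" | "\<not> balanced (toggle i x) j l"
    using unbalanced_opposite_or_adjacent[OF unbalanced] by blast
  then have "{toggle l x, toggle l (toggle i x)} \<subseteq> extremal
      \<or> {toggle l (toggle j x), toggle l (toggle i (toggle j x))} \<subseteq> extremal
      \<or> {toggle l x, toggle l (toggle j x)} \<subseteq> extremal
      \<or> {toggle l (toggle i x), toggle l (toggle i (toggle j x))} \<subseteq> extremal"
  proof cases
    case 1
    from face_extremal_if_unbalanced[OF vertices(3) ij(1,2) this] show ?thesis
      by (simp add: face_def toggle_commute[of l i])
  next
    case 2
    from face_extremal_if_unbalanced[OF x ij(1) l this] show ?thesis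
      by (simp add: face_def toggle_commute[of l i])
  next
    case 3
    from face_extremal_if_unbalanced[OF vertices(2) ij(1) l this] show ?thesis
      by (simp add: face_def toggle_commute[of l i])
  next
    case 4
    from face_extremal_if_unbalanced[OF x ij(2) l this] show ?thesis
      by (simp add: face_def toggle_commute[of l j])
  next
    case 5
    from face_extremal_if_unbalanced[OF vertices(1) ij(2) l this] show ?thesis
      by (simp add: face_def toggle_commute[of j l "toggle i x"] toggle_commute[of j i x])
  qed
  then show ?thesis
    using ij(3) by (auto simp: face_def toggle_commute[of i j])
qed

lemma card_extremal_fibre_ge:
  assumes x: "x \<in> Pow A" and ij: "i \<in> A" "j \<in> A" "i \<noteq> j" and unbalanced: "\<not> balanced x i j"
  defines "fibre \<equiv> \<lambda>z. {w \<in> extremal. w - {i, j} = z}"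
  shows "4 \<le> card (fibre (x - {i, j}))"
    and "l \<in> A - {i, j} \<Longrightarrow> 2 \<le> card (fibre (toggle l (x - {i, j})))"
proof -
  have finite_fibre: "finite (fibre z)" for z
    by (simp add: fibre_def finite_extremal)
  have project_face: "u - {i, j} = x - {i, j}" if "u \<in> face x i j" for u
    using that by (auto simp: face_def mem_toggle_iff)
  have "card (face x i j) \<le> card (fibre (x - {i, j}))"
    using face_extremal_if_unbalanced[OF x ij(1,2) unbalanced] project_face finite_fibre
    by (intro card_mono) (auto simp: fibre_def)
  then show "4 \<le> card (fibre (x - {i, j}))"
    by (simp add: card_face[OF ij(3)])
  assume l: "l \<in> A - {i, j}"
  obtain u v where uv: "u \<in> face x i j" "v \<in> face x i j" "u \<noteq> v"
    "toggle l u \<in> extremal" "toggle l v \<in> extremal"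
    using two_extremal_neighbours[OF x ij unbalanced, of l] l by blast
  have "toggle l w - {i, j} = toggle l (w - {i, j})" for w
    using l by (auto simp: mem_toggle_iff)
  then have "card {toggle l u, toggle l v} \<le> card (fibre (toggle l (x - {i, j})))"
    using uv project_face finite_fibre by (intro card_mono) (auto simp: fibre_def)
  then show "2 \<le> card (fibre (toggle l (x - {i, j})))"
    using uv(3) by simp
qed

lemma card_extremal_ge:
  assumes x: "x \<in> Pow A" and ij: "i \<in> A" "j \<in> A" "i \<noteq> j" and unbalanced: "\<not> balanced x i j"
  shows "2 * card A \<le> card extremal"
proof -
  define fibre where "fibre z = {w \<in> extremal. w - {i, j} = z}" for z
  define z where "z = x - {i, j}"
  let ?L = "A - {i, j}"
  note fibre_ge = card_extremal_fibre_ge[OF x ij unbalanced, folded z_def fibre_def]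
  have "2 * card ?L \<le> (\<Sum>l\<in>?L. card (fibre (toggle l z)))"
    using sum_mono[of ?L "\<lambda>_. 2" "\<lambda>l. card (fibre (toggle l z))"] fibre_ge(2) by simp
  also have "\<dots> = (\<Sum>y\<in>(\<lambda>l. toggle l z) ` ?L. card (fibre y))"
    by (subst sum.reindex) (auto simp: inj_on_def)
  finally have "4 + 2 * card ?L \<le> card (fibre z) + (\<Sum>y\<in>(\<lambda>l. toggle l z) ` ?L. card (fibre y))"
    using fibre_ge(1) by linarith
  also have "\<dots> = (\<Sum>y\<in>insert z ((\<lambda>l. toggle l z) ` ?L). card (fibre y))"
    using finite_A by (subst sum.insert) auto
  also have "\<dots> \<le> card extremal"
    unfolding fibre_def using finite_A finite_extremal by (intro sum_card_fibres_le) auto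
  finally show ?thesis
    using ij finite_A by (simp add: card_Diff_subset)
qed

theorem gap_le_or_many_extremal_labels:
  assumes a: "a \<in> A"
  shows "k + central_sum (card (A - {a})) \<le> 2 ^ card (A - {a})
    \<or> 2 * card A + 12 * k \<le> 4 * 2 ^ card A"
proof (cases "\<exists>x\<in>Pow A. \<exists>i\<in>A. \<exists>j\<in>A. \<not> balanced x i j")
  case True
  then obtain x i j where xij: "x \<in> Pow A" "i \<in> A" "j \<in> A" "\<not> balanced x i j"
    by blast
  moreover from this have "i \<noteq> j"
    by (auto simp: balanced_def)
  ultimately have "2 * card A \<le> 4 * (2 ^ card A - 3 * k)"
    using card_extremal_ge[of x i j] card_extremal_le by linarith
  moreover have "0 < card A"
    using a finite_A by (auto simp: card_gt_0_iff)
  ultimately show ?thesis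
    by linarith
next
  case False
  have "\<exists>h. h {} = 0 \<and> is_potential A orientation h"
    using finite_A orientation_toggle False by (intro is_potential_ex) (auto simp: balanced_def)
  then obtain h where "h {} = 0" "is_potential A orientation h"
    by blast
  then interpret numbering_with_height A \<eta> k a h
    by unfold_locales (use a in auto)
  show ?thesis
    using gap_le_if_height by simp
qed

end

section \<open>Parities of consecutive labels\<close>

context separated_numbering
begin

definition parity_window :: "bool \<Rightarrow> nat \<Rightarrow> 'a set set" where
  "parity_window b \<tau> = window \<tau> \<inter> parity_class A b"

definition even_labels :: "nat set" where
  "even_labels = \<eta> ` parity_class A True"

lemma finite_parity_window: "finite (parity_window b \<tau>)"
  using finite_A by (simp add: parity_window_def window_def)

lemma card_parity_window_add:
  assumes "1 \<le> \<tau>" "\<tau> + k \<le> 2 ^ card A + 1"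
  shows "card (parity_window b \<tau>) + card (parity_window (\<not> b) \<tau>) = k"
proof -
  have "parity_window b \<tau> \<union> parity_window (\<not> b) \<tau> = window \<tau>"
    "parity_window b \<tau> \<inter> parity_window (\<not> b) \<tau> = {}"
    by (auto simp: parity_window_def parity_class_def window_def)
  then show ?thesis
    using card_window[OF assms] by (metis card_Un_disjoint finite_parity_window)
qed

lemma card_parity_windows_le:
  assumes "a \<in> A" and "\<And>S. S \<subseteq> Pow (A - {a}) \<Longrightarrow> card S = card (parity_window b \<tau>) \<Longrightarrow>
      card (parity_window b \<tau>) + c \<le> card (closed_nbhd (A - {a}) S)"
  shows "card (parity_window b \<tau>) + c + card (parity_window (\<not> b) \<tau>) \<le> 2 ^ card (A - {a})"
  using assms toggle_notin_window
  by (intro card_add_le_if_no_edge[OF finite_A assms(1), where b = b])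
    (auto simp: parity_window_def)

lemma label_in_even_labels_iff: "x \<in> Pow A \<Longrightarrow> \<eta> x \<in> even_labels \<longleftrightarrow> even (card x)"
  unfolding even_labels_def
  by (subst inj_on_image_mem_iff[OF inj_on_label]) (auto simp: parity_class_def)

lemma card_parity_window_eq_sum:
  "card (parity_window True \<tau>) = (\<Sum>l = \<tau>..<\<tau> + k. of_bool (l \<in> even_labels))"
proof -
  have "\<eta> ` parity_window True \<tau> = {\<tau>..<\<tau> + k} \<inter> even_labels"
    by (auto simp: parity_window_def window_def even_labels_def parity_class_def)
  moreover have "card (\<eta> ` parity_window True \<tau>) = card (parity_window True \<tau>)"
    by (intro card_image inj_on_subset[OF inj_on_label]) (auto simp: parity_window_def window_def)
  ultimately show ?thesis
    by (simp add: of_bool_def sum.If_cases)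
qed

lemma card_even_labels:
  assumes "a \<in> A"
  shows "card even_labels = 2 ^ card (A - {a})"
proof -
  have "card even_labels = card (parity_class A True)"
    unfolding even_labels_def
    by (intro card_image inj_on_subset[OF inj_on_label]) (auto simp: parity_class_def)
  then show ?thesis
    by (simp add: card_parity_class[OF finite_A assms])
qed

lemma sum_card_parity_windows:
  assumes "a \<in> A" "m * k \<le> 2 ^ card A"
  shows "(\<Sum>t<m. card (parity_window True (Suc (t * k)))) \<le> 2 ^ card (A - {a})"
    and "2 ^ card (A - {a})
      \<le> (\<Sum>t<m. card (parity_window True (Suc (t * k)))) + (2 ^ card A - m * k)"
proof -
  define f :: "nat \<Rightarrow> nat" where "f l = of_bool (l \<in> even_labels)" for l
  let ?g = "\<lambda>l. f (Suc l)"
  have "card (parity_window True (Suc \<tau>)) = sum ?g {\<tau>..<\<tau> + k}" for \<tau>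
    unfolding card_parity_window_eq_sum f_def[symmetric]
    using sum.shift_bounds_Suc_ivl[of f \<tau> "\<tau> + k"] by (simp only: add_Suc)
  then have windows: "(\<Sum>t<m. card (parity_window True (Suc (t * k)))) = sum ?g {..<m * k}"
    by (simp only: sum.nat_group)
  have "even_labels \<subseteq> {Suc 0..<Suc (2 ^ card A)}"
    using label_bounds by (auto simp: even_labels_def parity_class_def less_Suc_eq_le)
  then have "card even_labels = sum f {Suc 0..<Suc (2 ^ card A)}"
    by (simp add: f_def of_bool_def sum.If_cases Int_absorb1 del: sum.op_ivl_Suc)
  also have "\<dots> = sum ?g {..<2 ^ card A}"
    unfolding sum.shift_bounds_Suc_ivl by (simp add: lessThan_atLeast0)
  also have "\<dots> = sum ?g {..<m * k} + sum ?g {m * k..<2 ^ card A}"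
    using assms(2) by (simp add: lessThan_atLeast0 sum.atLeastLessThan_concat)
  finally have "2 ^ card (A - {a}) = sum ?g {..<m * k} + sum ?g {m * k..<2 ^ card A}"
    by (simp add: card_even_labels[OF assms(1)])
  moreover have "sum ?g {m * k..<2 ^ card A} \<le> 2 ^ card A - m * k"
    using sum_bounded_above[of "{m * k..<2 ^ card A}" ?g 1] by (simp add: f_def)
  ultimately show "(\<Sum>t<m. card (parity_window True (Suc (t * k)))) \<le> 2 ^ card (A - {a})"
    "2 ^ card (A - {a})
      \<le> (\<Sum>t<m. card (parity_window True (Suc (t * k)))) + (2 ^ card A - m * k)"
    unfolding windows by linarith+
qed

lemma card_parity_window_Suc:
  "of_bool (\<tau> \<in> even_labels) + card (parity_window True (Suc \<tau>))
    = card (parity_window True \<tau>) + of_bool (\<tau> + k \<in> even_labels)"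
proof -
  let ?f = "\<lambda>l. of_bool (l \<in> even_labels) :: nat"
  have "(\<Sum>l = \<tau>..<\<tau> + k. ?f l) = ?f \<tau> + (\<Sum>l = Suc \<tau>..<\<tau> + k. ?f l)"
    using k_pos by (intro sum.atLeast_Suc_lessThan) simp
  moreover have "(\<Sum>l = Suc \<tau>..<Suc \<tau> + k. ?f l) = (\<Sum>l = Suc \<tau>..<\<tau> + k. ?f l) + ?f (\<tau> + k)"
    using k_pos by simp
  ultimately show ?thesis
    unfolding card_parity_window_eq_sum by simp
qed

text \<open>Constant counts make the parities of the labels periodic with period \<open>k\<close>, so the two labels of
  an edge cannot differ by exactly \<open>k\<close>.\<close>

lemma separated_numbering_Suc_if_card_parity_window_constant:
  assumes const: "\<And>\<tau>. 1 \<le> \<tau> \<Longrightarrow> \<tau> + k \<le> 2 ^ card A + 1 \<Longrightarrow> card (parity_window True \<tau>) = c"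
  shows "separated_numbering A \<eta> (Suc k)"
proof
  have period: "l \<in> even_labels \<longleftrightarrow> l + k \<in> even_labels" if "1 \<le> l" "l + k \<le> 2 ^ card A" for l
  proof -
    have "card (parity_window True l) = c" "card (parity_window True (Suc l)) = c"
      using that by (intro const; simp)+
    then have "of_bool (l \<in> even_labels) = (of_bool (l + k \<in> even_labels) :: nat)"
      using card_parity_window_Suc[of l] by linarith
    then show ?thesis
      by (simp only: of_bool_eq_iff)
  qed
  have neq: "\<eta> y \<noteq> \<eta> x + k" if "x \<in> Pow A" "y \<in> Pow A" "even (card x) \<noteq> even (card y)" for x y
  proof
    assume "\<eta> y = \<eta> x + k"
    then show False
      using period[of "\<eta> x"] label_bounds[OF that(1)] label_bounds[OF that(2)] that(3)
        label_in_even_labels_iff[OF that(1)] label_in_even_labels_iff[OF that(2)] by simp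
  qed
  fix x i assume x: "x \<in> Pow A" and i: "i \<in> A"
  have "finite x"
    using x finite_A finite_subset by auto
  then have "even (card x) \<noteq> even (card (toggle i x))"
    by (simp add: even_card_toggle)
  then have "\<eta> (toggle i x) \<noteq> \<eta> x + k" "\<eta> x \<noteq> \<eta> (toggle i x) + k"
    using neq x toggle_in_Pow[OF x i] by blast+
  then show "\<eta> x + Suc k \<le> \<eta> (toggle i x) \<or> \<eta> (toggle i x) + Suc k \<le> \<eta> x"
    using sep[OF x i] by linarith
qed (use finite_A bij in auto)

end

section \<open>The upper bound\<close>

lemma central_sum_values:
  "central_sum 1 = 1" "central_sum 2 = 2" "central_sum 3 = 4" "central_sum 4 = 7"
  "central_sum 5 = 13" "central_sum 6 = 23" "central_sum 7 = 43"
  by code_simp+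

lemma five_cube_isoperimetric:
  assumes S: "S \<subseteq> Pow {0, 1, 2, 3, 4 :: nat}" "card S = 8 \<or> card S = 9"
  shows "card S + 13 \<le> card (closed_nbhd {0, 1, 2, 3, 4} S)"
proof -
  have rank_empty: "rank {} {} = 0"
    by (simp add: rank_def)
  have choose: "4 choose Suc (Suc 0) = 6" "3 choose Suc (Suc 0) = 3"
    by (simp_all add: numeral_eq_Suc)
  have ranks: "rank {0, 1, 2, 3, 4 :: nat} {0, 2} = 7" "rank {0, 1, 2, 3, 4 :: nat} {0, 2, 4} = 20"
    "rank {0, 1, 2, 3, 4 :: nat} {0, 3} = 8" "rank {0, 1, 2, 3, 4 :: nat} {0, 3, 4} = 21"
    by (simp_all add: rank_insert_min small_subsets_Suc rank_empty choose insert_Diff_if)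
  then show ?thesis
    using S card_closed_nbhd_gt_rank[of "{0, 1, 2, 3, 4}" "{0, 2}" 4 S]
      card_closed_nbhd_gt_rank[of "{0, 1, 2, 3, 4}" "{0, 3}" 4 S]
    by (auto simp: insert_commute)
qed

lemma eq_10_if_steps_avoid:
  fixes e :: "nat \<Rightarrow> nat"
  assumes step: "\<And>\<tau>. e (Suc \<tau>) \<le> Suc (e \<tau>) \<and> e \<tau> \<le> Suc (e (Suc \<tau>))"
    and avoid: "\<And>\<tau>. 1 \<le> \<tau> \<Longrightarrow> \<tau> \<le> 45 \<Longrightarrow> e \<tau> \<notin> {8, 9, 11, 12}"
    and total: "e 1 + e 21 + e 41 \<le> 32" "28 \<le> e 1 + e 21 + e 41"
    and \<tau>: "1 \<le> \<tau>" "\<tau> \<le> 45"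
  shows "e \<tau> = 10"
proof -
  have region: "(e (Suc \<tau>) \<le> 7 \<longleftrightarrow> e \<tau> \<le> 7) \<and> (e (Suc \<tau>) = 10 \<longleftrightarrow> e \<tau> = 10)"
    if "1 \<le> \<tau>" "\<tau> < 45" for \<tau>
    using step[of \<tau>] avoid[of \<tau>] avoid[of "Suc \<tau>"] that by auto
  have same: "(e \<tau> \<le> 7 \<longleftrightarrow> e 1 \<le> 7) \<and> (e \<tau> = 10 \<longleftrightarrow> e 1 = 10)"
    if "1 \<le> \<tau>" "\<tau> \<le> 45" for \<tau>
    using that by (induction \<tau> rule: dec_induct) (simp_all add: region)
  have "e \<tau> \<le> 7 \<or> e \<tau> = 10 \<or> 13 \<le> e \<tau>" if "1 \<le> \<tau>" "\<tau> \<le> 45" for \<tau>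
    using avoid[OF that] by simp presburger
  from this[of 1] this[of 21] this[of 41] have "e 1 = 10"
    using total same[of 21] same[of 41] by auto
  then show ?thesis
    using same[OF \<tau>] by simp
qed

text \<open>By isoperimetry the number of even vertices in a window is never 8, 9, 11 or 12, so by its
  average it is constantly 10. Then every gap improves to 21, which leaves too few extremal labels.\<close>

lemma six_cube_gap_neq_20:
  fixes A :: "nat set"
  assumes num: "separated_numbering A \<eta> k" and a: "a \<in> A" "A - {a} = {0, 1, 2, 3, 4}"
  shows "k \<noteq> 20"
proof
  assume k: "k = 20"
  interpret separated_numbering A \<eta> k
    by fact
  have card_A: "card A = 6"
    using card_Suc_Diff1[OF finite_A a(1)] by (simp add: a(2))
  define e where "e \<tau> = card (parity_window True \<tau>)" for \<tau>
  have step: "e (Suc \<tau>) \<le> Suc (e \<tau>) \<and> e \<tau> \<le> Suc (e (Suc \<tau>))" for \<tau>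
    using card_parity_window_Suc[of \<tau>] by (auto simp: e_def of_bool_def split: if_splits)
  have avoid: "e \<tau> \<notin> {8, 9, 11, 12}" if "1 \<le> \<tau>" "\<tau> \<le> 45" for \<tau>
  proof -
    have "card (parity_window b \<tau>) + 13 + card (parity_window (\<not> b) \<tau>) \<le> 2 ^ card (A - {a})"
      if "card (parity_window b \<tau>) = 8 \<or> card (parity_window b \<tau>) = 9" for b
      using that five_cube_isoperimetric unfolding a(2)[symmetric]
      by (intro card_parity_windows_le[OF a(1)]) metis
    from this[of True] this[of False] show ?thesis
      using card_parity_window_add[of \<tau> True] that by (auto simp: e_def k card_A a(2))
  qed
  have "e 1 + e 21 + e 41 = (\<Sum>t<3. card (parity_window True (Suc (t * k))))"
    by (simp add: e_def k numeral_eq_Suc)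
  then have "e 1 + e 21 + e 41 \<le> 32" "28 \<le> e 1 + e 21 + e 41"
    using sum_card_parity_windows[OF a(1), of 3] by (simp_all add: k card_A a(2))
  then have "e \<tau> = 10" if "1 \<le> \<tau>" "\<tau> \<le> 45" for \<tau>
    using that by (intro eq_10_if_steps_avoid[of e, OF step avoid])
  then have "separated_numbering A \<eta> (Suc k)"
    by (intro separated_numbering_Suc_if_card_parity_window_constant[where c = 10])
      (simp add: e_def k card_A)
  from separated_numbering.gap_le_or_many_extremal_labels[OF this a(1)] show False
    by (simp add: k card_A a(2) central_sum_values)
qed

lemma central_binomial_Suc_le: "Suc d choose (Suc d div 2) \<le> 2 * (d choose (d div 2))"
proof (cases "Suc d div 2")
  case (Suc r)
  have "Suc d choose Suc r = (d choose r) + (d choose Suc r)"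
    by simp
  then show ?thesis
    using Suc binomial_maximum[of d r] binomial_maximum[of d "Suc r"] by simp
qed simp

lemma three_central_binomial_le:
  assumes "7 \<le> d"
  shows "3 * (d choose (d div 2)) \<le> 2 ^ d"
  using assms
proof (induction d rule: dec_induct)
  case base
  show ?case
    by code_simp
next
  case (step d)
  then show ?case
    using central_binomial_Suc_le[of d] by simp
qed

lemma six_central_sum_le:
  assumes "d \<noteq> 5"
  shows "6 * central_sum d \<le> 2 * 2 ^ d + d + 6"
proof (cases "7 \<le> d")
  case True
  then show ?thesis
  proof (induction d rule: dec_induct)
    case (step d)
    then show ?case
      using three_central_binomial_le[of d] by simp
  qed (simp add: central_sum_values)
next
  case False
  then consider "d = 0" | "d = 1" | "d = 2" | "d = 3" | "d = 4" | "d = 6"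
    using assms by linarith
  then show ?thesis
    by cases (simp_all add: central_sum_values)
qed

theorem separated_numbering_gap_le:
  assumes "separated_numbering {..<Suc d} \<eta> k"
  shows "k + central_sum d \<le> 2 ^ d"
proof (rule ccontr)
  assume "\<not> ?thesis"
  then have k: "2 ^ d < k + central_sum d"
    by simp
  have drop_top: "{..<Suc d} - {d} = {..<d}"
    by auto
  have many: "2 * Suc d + 12 * k \<le> 8 * 2 ^ d"
    using separated_numbering.gap_le_or_many_extremal_labels[OF assms, of d] k
    by (simp add: drop_top)
  show False
  proof (cases "d = 5")
    case True
    then have "k = 20"
      using many k by (simp add: central_sum_values)
    moreover have "{..<Suc d} - {d} = {0, 1, 2, 3, 4}"
      using True by auto
    ultimately show False
      using six_cube_gap_neq_20[OF assms, of d] by blast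
  next
    case False
    then show False
      using six_central_sum_le[OF False] many k by simp
  qed
qed

section \<open>Antibandwidth of finite graphs\<close>

lemma min_edge_gap_ge_iff:
  assumes "finite V" "v \<in> V" "w \<in> V" "adj v w"
  shows "c \<le> min_edge_gap V adj \<eta>
    \<longleftrightarrow> (\<forall>v\<in>V. \<forall>w\<in>V. adj v w \<longrightarrow> c \<le> \<bar>int (\<eta> v) - int (\<eta> w)\<bar>)"
proof -
  let ?gaps = "{\<bar>int (\<eta> v) - int (\<eta> w)\<bar> | v w. v \<in> V \<and> w \<in> V \<and> adj v w}"
  have "?gaps \<subseteq> (\<lambda>(v, w). \<bar>int (\<eta> v) - int (\<eta> w)\<bar>) ` (V \<times> V)"
    by auto
  then have "finite ?gaps"
    using assms(1) by (meson finite_SigmaI finite_imageI finite_subset)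
  moreover have "?gaps \<noteq> {}"
    using assms by blast
  ultimately have "c \<le> Min ?gaps \<longleftrightarrow> (\<forall>g\<in>?gaps. c \<le> g)"
    by (rule Min_ge_iff)
  then show ?thesis
    unfolding min_edge_gap_def by blast
qed

lemma antibandwidth_eqI:
  assumes V: "finite V" "v \<in> V" "w \<in> V" "adj v w"
    and attained: "numbering V \<eta>" "K \<le> min_edge_gap V adj \<eta>"
    and bound: "\<And>\<eta>. numbering V \<eta> \<Longrightarrow> min_edge_gap V adj \<eta> \<le> K"
  shows "antibandwidth V adj = K"
  unfolding antibandwidth_def
proof (rule Max_eqI)
  have "0 \<le> min_edge_gap V adj \<eta>" for \<eta>
    unfolding min_edge_gap_ge_iff[of V v w adj, OF V] by simp
  then have "{min_edge_gap V adj \<eta> | \<eta>. numbering V \<eta>} \<subseteq> {0..K}"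
    using bound by auto
  then show "finite {min_edge_gap V adj \<eta> | \<eta>. numbering V \<eta>}"
    using finite_subset by blast
  have "min_edge_gap V adj \<eta> = K"
    using attained bound by (intro antisym)
  then show "K \<in> {min_edge_gap V adj \<eta> | \<eta>. numbering V \<eta>}"
    using attained(1) by blast
qed (use bound in blast)

lemma min_edge_gaps_subset_if_isomorphic:
  assumes f: "bij_betw f V W"
    and adj: "\<And>v w. v \<in> V \<Longrightarrow> w \<in> V \<Longrightarrow> adj v w \<longleftrightarrow> adj' (f v) (f w)"
  shows "{min_edge_gap W adj' \<eta> | \<eta>. numbering W \<eta>} \<subseteq> {min_edge_gap V adj \<eta> | \<eta>. numbering V \<eta>}"
proof clarify
  fix \<eta> assume "numbering W \<eta>"
  then have "numbering V (\<eta> \<circ> f)"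
    using f bij_betw_trans bij_betw_same_card unfolding numbering_def by metis
  moreover have "min_edge_gap W adj' \<eta> = min_edge_gap V adj (\<eta> \<circ> f)"
  proof -
    have "{\<bar>int (\<eta> v) - int (\<eta> w)\<bar> | v w. v \<in> W \<and> w \<in> W \<and> adj' v w}
        = {\<bar>int ((\<eta> \<circ> f) v) - int ((\<eta> \<circ> f) w)\<bar> | v w. v \<in> V \<and> w \<in> V \<and> adj v w}"
      using adj bij_betw_imp_surj_on[OF f] by (auto simp: comp_def)
    then show ?thesis
      by (simp add: min_edge_gap_def)
  qed
  ultimately show "\<exists>\<eta>'. min_edge_gap W adj' \<eta> = min_edge_gap V adj \<eta>' \<and> numbering V \<eta>'"
    by blast
qed

lemma antibandwidth_eq_if_isomorphic:
  assumes f: "bij_betw f V W"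
    and adj: "\<And>v w. v \<in> V \<Longrightarrow> w \<in> V \<Longrightarrow> adj v w \<longleftrightarrow> adj' (f v) (f w)"
  shows "antibandwidth V adj = antibandwidth W adj'"
proof -
  have "adj' v w \<longleftrightarrow> adj (inv_into V f v) (inv_into V f w)" if "v \<in> W" "w \<in> W" for v w
    using that adj f by (simp add: bij_betw_inv_into_right bij_betw_imp_surj_on inv_into_into)
  then show ?thesis
    unfolding antibandwidth_def
    using min_edge_gaps_subset_if_isomorphic[of f V W adj adj', OF f adj]
      min_edge_gaps_subset_if_isomorphic[of "inv_into V f" W V adj' adj, OF bij_betw_inv_into[OF f]]
    by (metis (no_types, lifting) subset_antisym)
qed

section \<open>The hypercube\<close>

definition toggle_adj :: "'a set \<Rightarrow> 'a set \<Rightarrow> 'a set \<Rightarrow> bool" where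
  "toggle_adj A x y \<longleftrightarrow> (\<exists>i\<in>A. y = toggle i x)"

lemma separated_numbering_iff:
  assumes A: "finite A" "A \<noteq> {}" and k: "0 < k"
  shows "separated_numbering A \<eta> k
    \<longleftrightarrow> numbering (Pow A) \<eta> \<and> int k \<le> min_edge_gap (Pow A) (toggle_adj A) \<eta>"
proof -
  obtain a where a: "a \<in> A"
    using A(2) by blast
  have "toggle_adj A {} (toggle a {})" "toggle a {} \<in> Pow A"
    using a by (auto simp: toggle_adj_def toggle_def)
  then have "int k \<le> min_edge_gap (Pow A) (toggle_adj A) \<eta> \<longleftrightarrow>
      (\<forall>x\<in>Pow A. \<forall>y\<in>Pow A. toggle_adj A x y \<longrightarrow> int k \<le> \<bar>int (\<eta> x) - int (\<eta> y)\<bar>)"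
    using A(1) by (intro min_edge_gap_ge_iff[of _ "{}" "toggle a {}"]) auto
  also have "\<dots> \<longleftrightarrow> (\<forall>x\<in>Pow A. \<forall>i\<in>A. int k \<le> \<bar>int (\<eta> x) - int (\<eta> (toggle i x))\<bar>)"
    unfolding toggle_adj_def by (metis toggle_in_Pow)
  also have "\<dots> \<longleftrightarrow>
      (\<forall>x\<in>Pow A. \<forall>i\<in>A. \<eta> x + k \<le> \<eta> (toggle i x) \<or> \<eta> (toggle i x) + k \<le> \<eta> x)"
    by (intro ball_cong refl) linarith
  finally have gap: "int k \<le> min_edge_gap (Pow A) (toggle_adj A) \<eta> \<longleftrightarrow> \<dots>" .
  show ?thesis
    unfolding gap separated_numbering_def numbering_def using A(1) k by (auto simp: card_Pow)
qed

lemma min_edge_gap_toggle_adj_le: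
  assumes "numbering (Pow {..<Suc d}) \<eta>"
  shows "min_edge_gap (Pow {..<Suc d}) (toggle_adj {..<Suc d}) \<eta> \<le> 2 ^ d - int (central_sum d)"
    (is "?g \<le> _")
proof (cases "0 < ?g")
  case True
  then have "separated_numbering {..<Suc d} \<eta> (nat ?g)"
    using assms by (subst separated_numbering_iff) (auto simp: lessThan_empty_iff)
  from separated_numbering_gap_le[OF this] have "int (nat ?g + central_sum d) \<le> int (2 ^ d)"
    by (simp only: of_nat_le_iff)
  then show ?thesis
    using True by simp
next
  case False
  have "int (central_sum d) < 2 ^ d"
    using central_sum_less[of d] by simp
  with False show ?thesis
    by linarith
qed

theorem antibandwidth_toggle_adj:
  "antibandwidth (Pow {..<Suc d}) (toggle_adj {..<Suc d}) = 2 ^ d - int (central_sum d)"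
proof (rule antibandwidth_eqI)
  let ?A = "{..<Suc d}" and ?k = "2 ^ d - central_sum d"
  have k: "0 < ?k" "int ?k = 2 ^ d - int (central_sum d)"
    using central_sum_less[of d] by (simp_all add: of_nat_diff)
  have "?A - {d} = {..<d}"
    by auto
  then have "separated_numbering ?A (parity_rank_numbering ?A d) ?k"
    using separated_parity_rank_numbering[of ?A d] by simp
  then show "numbering (Pow ?A) (parity_rank_numbering ?A d)"
    "2 ^ d - int (central_sum d)
      \<le> min_edge_gap (Pow ?A) (toggle_adj ?A) (parity_rank_numbering ?A d)"
    using separated_numbering_iff[of ?A ?k] k by (auto simp: lessThan_empty_iff)
  show "toggle_adj ?A {} (toggle d {})"
    by (auto simp: toggle_adj_def)
qed (auto simp: toggle_def min_edge_gap_toggle_adj_le)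

definition true_positions :: "bool list \<Rightarrow> nat set" where
  "true_positions xs = {i. i < length xs \<and> xs ! i}"

lemma bij_betw_true_positions: "bij_betw true_positions (cube_vertices n) (Pow {..<n})"
proof (rule bij_betw_byWitness[where f' = "\<lambda>x. map (\<lambda>i. i \<in> x) [0..<n]"])
  show "\<forall>xs\<in>cube_vertices n. map (\<lambda>i. i \<in> true_positions xs) [0..<n] = xs"
    by (auto simp: true_positions_def cube_vertices_def intro!: nth_equalityI)
qed (auto simp: true_positions_def cube_vertices_def)

lemma cube_adj_iff_toggle_adj:
  assumes "xs \<in> cube_vertices n" "ys \<in> cube_vertices n"
  shows "cube_adj xs ys \<longleftrightarrow> toggle_adj {..<n} (true_positions xs) (true_positions ys)"
proof -
  have len: "length xs = n" "length ys = n"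
    using assms by (auto simp: cube_vertices_def)
  have "{j. j < n \<and> xs ! j \<noteq> ys ! j} = {i}
      \<longleftrightarrow> i < n \<and> true_positions ys = toggle i (true_positions xs)" for i
    using len by (auto simp: set_eq_iff true_positions_def mem_toggle_iff)
  then show ?thesis
    using len by (auto simp: cube_adj_def toggle_adj_def card_1_singleton_iff)
qed

theorem theorem3:
  fixes n :: nat
  assumes "n \<ge> 1"
  shows "antibandwidth (cube_vertices n) cube_adj =
           2 ^ (n - 1) - (\<Sum>m = 0..<n - 1. int (m choose (m div 2)))"
proof -
  obtain d where n: "n = Suc d"
    using assms by (cases n) auto
  have "antibandwidth (cube_vertices n) cube_adj = antibandwidth (Pow {..<n}) (toggle_adj {..<n})"
    by (rule antibandwidth_eq_if_isomorphic[OF bij_betw_true_positions])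
      (rule cube_adj_iff_toggle_adj)
  also have "\<dots> = 2 ^ d - int (central_sum d)"
    unfolding n by (rule antibandwidth_toggle_adj)
  finally show ?thesis
    by (simp add: n central_sum_def lessThan_atLeast0)
qed

end
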